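(* (i) If two functions $f,g\in\mathcal O_n$ (germs $(\mathbb C^n,0)\to(\mathbb C,0)$) are bi-Lipschitz $\mathcal K$-equivalent, then $\operatorname{lct}(f)=\operatorname{lct}(g)$. (ii) If two ideals $I$ and $J$ of $\mathcal O_n$ are bi-Lipschitz equivalent, then $\operatorname{lct}(I)=\operatorname{lct}(J)$.
   Context: $\mathcal O_n$ is the ring of complex analytic function germs $(\mathbb C^n,0)\to\mathbb C$; $\overline I$ denotes integral closure. The log canonical threshold $\operatorname{lct}(I)$ of an ideal $I=\langle g_1,\dots,g_r\rangle$ of $\mathcal O_n$ is the supremum of those $s\in\mathbb R_{\geq0}$ such that $(|g_1(x)|^2+\cdots+|g_r(x)|^2)^{-s}$ is integrable on some compact neighbourhood of $0$ (independent of the generators); for a function, $\operatorname{lct}(f)$ is the supremum of those $s$ such that $|f(x)|^{-2s}$ is locally integrable at $0$. A homeomorphism germ is bi-Lipschitz if it and its inverse are Lipschitz near $0$. Map germs $f,g:(\mathbb C^n,0)\to(\mathbb C^p,0)$ are bi-Lipschitz $\mathcal K$-equivalent if there are a bi-Lipschitz homeomorphism $\varphi:(\mathbb C^n,0)\to(\mathbb C^n,0)$ and a bi-Lipschitz homeomorphism $\Phi:(\mathbb C^n\times\mathbb C^p,0)\to(\mathbb C^n\times\mathbb C^p,0)$ of the form $(x,y)\mapsto(\varphi(x),\phi_x(y))$ such that $\Phi(\mathbb C^n\times\{0\})=\mathbb C^n\times\{0\}$ and $\phi_x(f(x))=g(\varphi(x))$ for all $x$ in some open neighbourhood of $0$.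 For nonnegative function germs, $a\sim b$ near $0$ means that each is bounded by a positive constant times the other on a neighbourhood of $0$. Ideals $I$ and $J$ of $\mathcal O_n$ are bi-Lipschitz equivalent if there exist $f_1,\dots,f_p$ and $g_1,\dots,g_q$ in $\mathcal O_n$ such that: (a) $\langle f_1,\dots,f_p\rangle\subseteq I$ and $\overline{\langle f_1,\dots,f_p\rangle}=\overline I$; (b) $\langle g_1,\dots,g_q\rangle\subseteq J$ and $\overline{\langle g_1,\dots,g_q\rangle}=\overline J$; (c) there is a bi-Lipschitz homeomorphism $\varphi:(\mathbb C^n,0)\to(\mathbb C^n,0)$ such that $\|(f_1(x),\dots,f_p(x))\|\sim\|(g_1(\varphi(x)),\dots,g_q(\varphi(x)))\|$ near $0$. *)

theory Defs
  imports
    "HOL-Analysis.Analysis"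
    "HOL-Library.Landau_Symbols"
    "HOL-Algebra.QuotRing"
    "HOL-Algebra.Ideal_Product"
begin

section \<open>The ring of germs of analytic functions at the origin\<close>

definition monomial_at :: "complex ^ 'n \<Rightarrow> ('n \<Rightarrow> nat) \<Rightarrow> complex" where
  "monomial_at x \<alpha> = (\<Prod>i\<in>UNIV. (x $ i) ^ \<alpha> i)"

text \<open>The dimension is the size of the index type \<open>'n\<close>, and a multi-index is a function
  \<open>'n \<Rightarrow> nat\<close>. The value of the function away from the origin is irrelevant.\<close>

definition analytic_at_origin :: "(complex ^ 'n \<Rightarrow> complex) \<Rightarrow> bool" where
  "analytic_at_origin f \<longleftrightarrow>
     (\<exists>c. \<forall>\<^sub>F x in nhds 0. ((\<lambda>\<alpha>. c \<alpha> * monomial_at x \<alpha>) has_sum f x) UNIV)"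

definition analytic_functions :: "(complex ^ 'n \<Rightarrow> complex) ring" where
  "analytic_functions =
     \<lparr>carrier = {f. analytic_at_origin f},
      mult = (\<lambda>f g x. f x * g x), one = (\<lambda>x. 1),
      zero = (\<lambda>x. 0), add = (\<lambda>f g x. f x + g x)\<rparr>"

definition vanishing_near_origin :: "(complex ^ 'n \<Rightarrow> complex) set" where
  "vanishing_near_origin = {f. \<forall>\<^sub>F x in nhds 0. f x = 0}"

definition germ_ring :: "(complex ^ 'n \<Rightarrow> complex) set ring" (\<open>\<O>\<close>) where
  "\<O> = analytic_functions Quot vanishing_near_origin"

definition germ :: "(complex ^ 'n \<Rightarrow> complex) \<Rightarrow> (complex ^ 'n \<Rightarrow> complex) set" where
  "germ f = vanishing_near_origin +>\<^bsub>analytic_functions\<^esub> f"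

definition ideal_generated_by ::
    "(complex ^ 'n \<Rightarrow> complex) list \<Rightarrow> (complex ^ 'n \<Rightarrow> complex) set set" where
  "ideal_generated_by gs = Idl\<^bsub>\<O>\<^esub> (germ ` set gs)"

lemma analytic_at_origin_const: "analytic_at_origin (\<lambda>x :: complex ^ 'n. k)"
proof -
  define c :: "('n \<Rightarrow> nat) \<Rightarrow> complex" where "c = (\<lambda>\<alpha>. if \<alpha> = (\<lambda>i. 0) then k else 0)"
  have "((\<lambda>\<alpha>. c \<alpha> * monomial_at x \<alpha>) has_sum k) UNIV" for x :: "complex ^ 'n"
  proof -
    have "((\<lambda>\<alpha>. c \<alpha> * monomial_at x \<alpha>) has_sum k) {\<lambda>i. 0}"
      using has_sum_finite[of "{\<lambda>i. 0}" "\<lambda>\<alpha>. c \<alpha> * monomial_at x \<alpha>"]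
      by (simp add: c_def monomial_at_def)
    then show ?thesis
      by (rule has_sum_cong_neutral[THEN iffD1, rotated -1]) (auto simp: c_def)
  qed
  then show ?thesis
    unfolding analytic_at_origin_def by (intro exI[of _ c]) simp
qed

lemma analytic_at_origin_add:
  assumes "analytic_at_origin f" "analytic_at_origin g"
  shows "analytic_at_origin (\<lambda>x. f x + g x)"
proof -
  obtain c d where
    "\<forall>\<^sub>F x in nhds 0. ((\<lambda>\<alpha>. c \<alpha> * monomial_at x \<alpha>) has_sum f x) UNIV"
    "\<forall>\<^sub>F x in nhds 0. ((\<lambda>\<alpha>. d \<alpha> * monomial_at x \<alpha>) has_sum g x) UNIV"
    using assms unfolding analytic_at_origin_def by blast
  then have "\<forall>\<^sub>F x in nhds 0. ((\<lambda>\<alpha>. (c \<alpha> + d \<alpha>) * monomial_at x \<alpha>) has_sum f x + g x) UNIV"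
    by eventually_elim (simp add: distrib_right has_sum_add)
  then show ?thesis
    unfolding analytic_at_origin_def by (rule exI[of _ "\<lambda>\<alpha>. c \<alpha> + d \<alpha>"])
qed

lemma has_sum_mult_complex:
  fixes a :: "'a \<Rightarrow> complex" and b :: "'b \<Rightarrow> complex"
  assumes "(a has_sum s) UNIV" "(b has_sum t) UNIV"
  shows "((\<lambda>(i, j). a i * b j) has_sum s * t) UNIV"
proof -
  have "(\<lambda>i. norm (a i)) summable_on UNIV" "(\<lambda>j. norm (b j)) summable_on UNIV"
    using assms has_sum_imp_summable summable_on_iff_abs_summable_on_complex by blast+
  then have "(\<lambda>p. norm ((\<lambda>(i, j). a i * b j) p)) summable_on UNIV \<times> UNIV"
    unfolding Infinite_Sum.abs_summable_on_Sigma_iff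
    by (auto simp: norm_mult infsum_cmult_right' abs_mult infsum_nonneg summable_on_cmult_right
        summable_on_cmult_left)
  then have "(\<lambda>(i, j). a i * b j) summable_on UNIV \<times> UNIV"
    by (rule abs_summable_summable)
  then obtain u where u: "((\<lambda>(i, j). a i * b j) has_sum u) (UNIV \<times> UNIV)"
    using summable_on_def by blast
  have "((\<lambda>i. a i * t) has_sum u) UNIV"
    by (rule has_sum_SigmaD[OF u]) (use assms(2) has_sum_cmult_right in auto)
  moreover have "((\<lambda>i. a i * t) has_sum s * t) UNIV"
    by (rule has_sum_cmult_left[OF assms(1)])
  ultimately have "u = s * t"
    by (rule has_sum_unique)
  with u show ?thesis by simp
qed

lemma analytic_at_origin_mult:
  fixes f g :: "complex ^ 'n \<Rightarrow> complex"
  assumes "analytic_at_origin f" "analytic_at_origin g"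
  shows "analytic_at_origin (\<lambda>x. f x * g x)"
proof -
  obtain c d where cd:
    "\<forall>\<^sub>F x in nhds 0. ((\<lambda>\<alpha>. c \<alpha> * monomial_at x \<alpha>) has_sum f x) UNIV"
    "\<forall>\<^sub>F x in nhds 0. ((\<lambda>\<alpha>. d \<alpha> * monomial_at x \<alpha>) has_sum g x) UNIV"
    using assms unfolding analytic_at_origin_def by blast
  define plus where "plus = (\<lambda>p :: ('n \<Rightarrow> nat) \<times> ('n \<Rightarrow> nat). \<lambda>i. fst p i + snd p i)"
  define F where "F = (\<lambda>\<gamma>. {p. plus p = \<gamma>})"
  define e where "e = (\<lambda>\<gamma>. \<Sum>p\<in>F \<gamma>. c (fst p) * d (snd p))"
  have fin: "finite (F \<gamma>)" for \<gamma>
  proof -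
    have "F \<gamma> \<subseteq> (Pi\<^sub>E UNIV (\<lambda>i. {..\<gamma> i})) \<times> (Pi\<^sub>E UNIV (\<lambda>i. {..\<gamma> i}))"
      by (auto simp: F_def plus_def)
    moreover have "finite (Pi\<^sub>E (UNIV :: 'n set) (\<lambda>i. {..\<gamma> i}))"
      by (rule finite_PiE) auto
    ultimately show ?thesis
      using finite_subset by blast
  qed
  have "((\<lambda>\<gamma>. e \<gamma> * monomial_at x \<gamma>) has_sum f x * g x) UNIV"
    if f: "((\<lambda>\<alpha>. c \<alpha> * monomial_at x \<alpha>) has_sum f x) UNIV"
    and g: "((\<lambda>\<alpha>. d \<alpha> * monomial_at x \<alpha>) has_sum g x) UNIV" for x
  proof -
    define h where "h = (\<lambda>(\<alpha>, \<beta>). (c \<alpha> * monomial_at x \<alpha>) * (d \<beta> * monomial_at x \<beta>))"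
    have "(h has_sum f x * g x) UNIV"
      unfolding h_def by (rule has_sum_mult_complex[OF f g])
    moreover have "bij_betw snd (Sigma UNIV F) UNIV"
      by (auto simp: bij_betw_def inj_on_def F_def image_iff)
    ultimately have "((\<lambda>q. h (snd q)) has_sum f x * g x) (Sigma UNIV F)"
      using has_sum_reindex_bij_betw[of snd "Sigma UNIV F" UNIV h "f x * g x"] by simp
    moreover have "((\<lambda>p. h (snd (\<gamma>, p))) has_sum e \<gamma> * monomial_at x \<gamma>) (F \<gamma>)" for \<gamma>
    proof -
      have "h p = c (fst p) * d (snd p) * monomial_at x \<gamma>" if "p \<in> F \<gamma>" for p
      proof -
        have "monomial_at x \<gamma> = monomial_at x (fst p) * monomial_at x (snd p)"
          using that by (auto simp: F_def plus_def monomial_at_def power_add prod.distrib)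
        then show ?thesis
          by (simp add: h_def case_prod_unfold)
      qed
      then have "sum h (F \<gamma>) = e \<gamma> * monomial_at x \<gamma>"
        by (simp add: e_def sum_distrib_right)
      then show ?thesis
        using has_sum_finite[OF fin, of h \<gamma>] by simp
    qed
    ultimately show ?thesis
      by (rule has_sum_SigmaD)
  qed
  with cd have "\<forall>\<^sub>F x in nhds 0. ((\<lambda>\<gamma>. e \<gamma> * monomial_at x \<gamma>) has_sum f x * g x) UNIV"
    by (auto elim: eventually_elim2)
  then show ?thesis
    unfolding analytic_at_origin_def by blast
qed

lemma vanishing_imp_analytic: "f \<in> vanishing_near_origin \<Longrightarrow> analytic_at_origin f"
  unfolding vanishing_near_origin_def analytic_at_origin_def
  by (intro exI[of _ "\<lambda>\<alpha>. 0"]) (auto elim: eventually_mono)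

lemma cring_analytic_functions: "cring analytic_functions"
proof (rule cringI)
  show "abelian_group analytic_functions"
  proof (rule abelian_groupI)
    fix f :: "complex ^ 'n \<Rightarrow> complex"
    assume "f \<in> carrier analytic_functions"
    then show "\<exists>g\<in>carrier analytic_functions.
        g \<oplus>\<^bsub>analytic_functions\<^esub> f = \<zero>\<^bsub>analytic_functions\<^esub>"
      using analytic_at_origin_mult[OF analytic_at_origin_const[of "-1"], of f]
      by (intro bexI[of _ "\<lambda>x. - 1 * f x"]) (auto simp: analytic_functions_def)
  qed (auto simp: analytic_functions_def analytic_at_origin_add analytic_at_origin_const)
  show "comm_monoid analytic_functions"
    by (rule comm_monoidI)
      (auto simp: analytic_functions_def analytic_at_origin_mult analytic_at_origin_const)
qed (auto simp: analytic_functions_def distrib_right)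

lemma ideal_vanishing_near_origin:
  "ideal vanishing_near_origin (analytic_functions :: (complex ^ 'n \<Rightarrow> complex) ring)"
proof (rule idealI)
  interpret cring "analytic_functions :: (complex ^ 'n \<Rightarrow> complex) ring"
    by (rule cring_analytic_functions)
  show "ring (analytic_functions :: (complex ^ 'n \<Rightarrow> complex) ring)"
    by (rule ring_axioms)
  show "subgroup vanishing_near_origin
      (add_monoid (analytic_functions :: (complex ^ 'n \<Rightarrow> complex) ring))"
  proof (rule add.subgroupI)
    show "vanishing_near_origin \<subseteq> carrier (analytic_functions :: (complex ^ 'n \<Rightarrow> complex) ring)"
      by (auto simp: analytic_functions_def vanishing_imp_analytic)
    show "vanishing_near_origin \<noteq> ({} :: (complex ^ 'n \<Rightarrow> complex) set)"
      by (auto simp: vanishing_near_origin_def intro!: exI[of _ "\<lambda>x. 0"])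
  next
    fix f :: "complex ^ 'n \<Rightarrow> complex" assume f: "f \<in> vanishing_near_origin"
    then have fc: "f \<in> carrier analytic_functions"
      by (simp add: analytic_functions_def vanishing_imp_analytic)
    have "\<ominus>\<^bsub>analytic_functions\<^esub> f = (\<lambda>x. - 1 * f x)"
      by (rule minus_equality)
        (use fc analytic_at_origin_mult[OF analytic_at_origin_const[of "-1"], of f]
          in \<open>auto simp: analytic_functions_def\<close>)
    then show "\<ominus>\<^bsub>analytic_functions\<^esub> f \<in> vanishing_near_origin"
      using f by (simp add: vanishing_near_origin_def)
  next
    fix f g :: "complex ^ 'n \<Rightarrow> complex"
    assume "f \<in> vanishing_near_origin" "g \<in> vanishing_near_origin"
    then show "f \<oplus>\<^bsub>analytic_functions\<^esub> g \<in> vanishing_near_origin"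
      by (auto simp: vanishing_near_origin_def analytic_functions_def elim: eventually_elim2)
  qed
qed (auto simp: vanishing_near_origin_def analytic_functions_def elim: eventually_mono)

lemma cring_germ_ring: "cring \<O>"
  unfolding germ_ring_def
  by (rule ideal.quotient_is_cring[OF ideal_vanishing_near_origin cring_analytic_functions])

lemma carrier_germ_ring: "carrier \<O> = germ ` {f. analytic_at_origin f}"
  by (auto simp: germ_ring_def germ_def FactRing_def A_RCOSETS_def' a_r_coset_def'
      analytic_functions_def)

lemma mem_germ_iff: "g \<in> germ f \<longleftrightarrow> (\<forall>\<^sub>F x in nhds 0. g x = f x)"
proof -
  have "(\<exists>h\<in>vanishing_near_origin. g = (\<lambda>x. h x + f x))
      \<longleftrightarrow> (\<lambda>x. g x - f x) \<in> vanishing_near_origin" (is "?L \<longleftrightarrow> ?R")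
  proof
    assume ?R
    then show ?L by (rule bexI[rotated]) auto
  qed auto
  then show ?thesis
    by (simp add: germ_def a_r_coset_def' analytic_functions_def vanishing_near_origin_def)
qed

lemma germ_eq_iff: "germ f = germ g \<longleftrightarrow> (\<forall>\<^sub>F x in nhds 0. f x = g x)"
proof
  assume "germ f = germ g"
  then have "f \<in> germ g"
    using mem_germ_iff[of f f] by simp
  then show "\<forall>\<^sub>F x in nhds 0. f x = g x"
    by (simp add: mem_germ_iff)
next
  assume fg: "\<forall>\<^sub>F x in nhds 0. f x = g x"
  show "germ f = germ g"
  proof (rule Set.set_eqI)
    fix h
    have "(\<forall>\<^sub>F x in nhds 0. h x = f x) \<longleftrightarrow> (\<forall>\<^sub>F x in nhds 0. h x = g x)"
      by (rule eventually_cong[OF fg]) simp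
    then show "h \<in> germ f \<longleftrightarrow> h \<in> germ g"
      by (simp add: mem_germ_iff)
  qed
qed


section \<open>Integral closure of an ideal\<close>

primrec ideal_power :: "('a, 'b) ring_scheme \<Rightarrow> 'a set \<Rightarrow> nat \<Rightarrow> 'a set" where
  "ideal_power R I 0 = carrier R"
| "ideal_power R I (Suc k) = ideal_prod R I (ideal_power R I k)"

definition integral_closure :: "('a, 'b) ring_scheme \<Rightarrow> 'a set \<Rightarrow> 'a set" where
  "integral_closure R I =
     {h \<in> carrier R. \<exists>k a. 1 \<le> k \<and> (\<forall>i\<in>{1..k}. a i \<in> ideal_power R I i) \<and>
        h [^]\<^bsub>R\<^esub> k \<oplus>\<^bsub>R\<^esub> (\<Oplus>\<^bsub>R\<^esub>i\<in>{1..k}. a i \<otimes>\<^bsub>R\<^esub> h [^]\<^bsub>R\<^esub> (k - i)) = \<zero>\<^bsub>R\<^esub>}"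


section \<open>Log canonical thresholds\<close>

text \<open>\<open>u\<close> to the power \<open>-s\<close> for \<open>u, s \<ge> 0\<close>, infinite where \<open>u = 0 < s\<close>; \<open>powr\<close> itself
  gives \<open>0\<close> there.\<close>

definition neg_powr :: "real \<Rightarrow> real \<Rightarrow> ennreal" where
  "neg_powr u s = (if u = 0 then (if s = 0 then 1 else \<infinity>) else ennreal (u powr (- s)))"

definition integrable_near_origin :: "('a::euclidean_space \<Rightarrow> ennreal) \<Rightarrow> bool" where
  "integrable_near_origin h \<longleftrightarrow>
     (\<exists>K. compact K \<and> 0 \<in> interior K \<and>
        (\<lambda>x. h x * indicator K x) \<in> borel_measurable lborel \<and>
        (\<integral>\<^sup>+x\<in>K. h x \<partial>lborel) < \<infinity>)"

definition lct_function :: "(complex ^ 'n \<Rightarrow> complex) \<Rightarrow> ereal" where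
  "lct_function f =
     Sup (ereal ` {s. 0 \<le> s \<and> integrable_near_origin (\<lambda>x. neg_powr (cmod (f x)) (2 * s))})"

text \<open>Integrability does not depend on the choice of the finite generating family \<open>gs\<close>.\<close>

definition lct_ideal :: "(complex ^ 'n \<Rightarrow> complex) set set \<Rightarrow> ereal" where
  "lct_ideal I =
     Sup (ereal ` {s. 0 \<le> s \<and>
       (\<exists>gs. (\<forall>g\<in>set gs. analytic_at_origin g) \<and> I = ideal_generated_by gs \<and>
          integrable_near_origin (\<lambda>x. neg_powr (\<Sum>g\<leftarrow>gs. (cmod (g x))\<^sup>2) s))})"


section \<open>Bi-Lipschitz equivalences\<close>

definition bilipschitz_homeo ::
    "'a::real_normed_vector set \<Rightarrow> 'b::real_normed_vector set \<Rightarrow> ('a \<Rightarrow> 'b) \<Rightarrow> bool" where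
  "bilipschitz_homeo U V \<phi> \<longleftrightarrow>
     open U \<and> open V \<and> 0 \<in> U \<and> 0 \<in> V \<and> \<phi> 0 = 0 \<and>
     (\<exists>\<psi> C. homeomorphism U V \<phi> \<psi> \<and> C-lipschitz_on U \<phi> \<and> C-lipschitz_on V \<psi>)"

definition bilipschitz_homeo_germ ::
    "('a::real_normed_vector \<Rightarrow> 'b::real_normed_vector) \<Rightarrow> bool" where
  "bilipschitz_homeo_germ \<phi> \<longleftrightarrow> (\<exists>U V. bilipschitz_homeo U V \<phi>)"

text \<open>The condition on the image of \<open>UNIV \<times> {0}\<close> is an equality of set germs; the domain \<open>U\<close> and
  range \<open>V\<close> of the representative can be shrunk so that it holds as an equality of sets.\<close>

definition bilipschitz_K_equivalent ::
    "('a::real_normed_vector \<Rightarrow> 'b::real_normed_vector) \<Rightarrow> ('a \<Rightarrow> 'b) \<Rightarrow> bool" where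
  "bilipschitz_K_equivalent f g \<longleftrightarrow>
     (\<exists>\<phi> \<theta> U V.
        bilipschitz_homeo_germ \<phi> \<and>
        bilipschitz_homeo U V (\<lambda>(x, y). (\<phi> x, \<theta> x y)) \<and>
        (\<lambda>(x, y). (\<phi> x, \<theta> x y)) ` (U \<inter> UNIV \<times> {0}) = V \<inter> UNIV \<times> {0} \<and>
        (\<forall>\<^sub>F x in nhds 0. \<theta> x (f x) = g (\<phi> x)))"

definition tuple_norm :: "('a \<Rightarrow> complex) list \<Rightarrow> 'a \<Rightarrow> real" where
  "tuple_norm fs x = sqrt (\<Sum>f\<leftarrow>fs. (cmod (f x))\<^sup>2)"

definition bilipschitz_equivalent_ideals ::
    "(complex ^ 'n \<Rightarrow> complex) set set \<Rightarrow> (complex ^ 'n \<Rightarrow> complex) set set \<Rightarrow> bool" where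
  "bilipschitz_equivalent_ideals I J \<longleftrightarrow>
     (\<exists>fs gs \<phi>.
        (\<forall>f\<in>set fs. analytic_at_origin f) \<and> (\<forall>g\<in>set gs. analytic_at_origin g) \<and>
        ideal_generated_by fs \<subseteq> I \<and>
        integral_closure \<O> (ideal_generated_by fs) = integral_closure \<O> I \<and>
        ideal_generated_by gs \<subseteq> J \<and>
        integral_closure \<O> (ideal_generated_by gs) = integral_closure \<O> J \<and>
        bilipschitz_homeo_germ \<phi> \<and>
        tuple_norm fs \<in> \<Theta>[nhds 0](\<lambda>x. tuple_norm gs (\<phi> x)))"

end

theory Submission
  imports Defs "HOL-Library.Function_Algebras" "HOL-Computational_Algebra.Primes"
begin

text \<open>Both parts rest on one fact (\<open>integrable_near_origin_transfer\<close>): if \<open>\<phi>\<close> is bi-Lipschitz and \<open>u\<close> is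
bounded by a multiple of \<open>v \<circ> \<phi>\<close>, then integrability of \<open>u ^ (- s)\<close> near the origin implies that of
\<open>v ^ (- s)\<close>, for continuous \<open>v\<close>. Indeed a Lipschitz map enlarges Lebesgue measure by at most a constant factor: the balls of
a Vitali covering have images in balls of proportional radius. What remains is to compare the
functions that enter the two thresholds.

For a \<open>\<K>\<close>-equivalence \<open>\<Phi>(x, y) = (\<phi> x, \<theta> x y)\<close> of \<open>f\<close> and \<open>g\<close>, the points \<open>(x, f x)\<close> and \<open>(x, 0)\<close>
are at distance \<open>|f x|\<close> and their images \<open>(\<phi> x, g (\<phi> x))\<close> and \<open>(\<phi> x, 0)\<close> at distance \<open>|g (\<phi> x)|\<close>.
As \<open>\<Phi>\<close> and its inverse are Lipschitz, \<open>|f|\<close> is comparable to \<open>|g \<circ> \<phi>|\<close>.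

For ideals, the given families \<open>fs\<close> and \<open>gs\<close> only have the integral closures of \<open>I\<close> and \<open>J\<close>, whereas
the threshold refers to generators. Every element of \<open>I\<close> is integral over \<open>\<langle>fs\<rangle>\<close>, and the
integral equation bounds it by a multiple of \<open>\<parallel>fs\<parallel>\<close>, so \<open>\<parallel>fs\<parallel>\<close> is comparable to the norm of any
generating family of \<open>I\<close> (\<open>generators_equivalent\<close>).

The threshold of an ideal is a supremum over its finite generating families, hence the argument also
requires that \<open>I\<close> and \<open>J\<close> have such families: the ring of convergent power series is Noetherian
(\<open>germ_ring_noetherian\<close>). The proof is by Grauert division, which treats all variables at once.
The monomial with exponent \<open>\<alpha>\<close> gets the weight \<open>\<Prod>i. p\<^sub>i ^ \<alpha> i\<close> for distinct primes \<open>p\<^sub>i\<close>. By unique factorization this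
orders the monomials linearly, compatibly with multiplication, and with finitely many below each one.
A power series converges near the origin exactly if its coefficients grow at most like a power of the
weight, as for Dirichlet series. By Dickson's lemma finitely many \<open>f\<^sub>1, \<dots>, f\<^sub>m \<in> I\<close> have
initial monomials that generate all the initial monomials of \<open>I\<close>. Dividing an element of \<open>I\<close> by
\<open>f\<^sub>1, \<dots>, f\<^sub>m\<close> leaves a remainder in \<open>I\<close> none of whose monomials is divisible by these initial
monomials, so the remainder vanishes. The division is a recursion along the weight, and an induction
along the weight shows that it preserves polynomial growth.\<close>

section \<open>A weight that orders the monomials\<close>

text \<open>Evaluating at the point with coordinates \<open>1 / p\<^sub>i ^ s\<close> turns a power series into a Dirichlet series
in \<open>s\<close>.\<close>

definition variable_prime :: "'n::finite \<Rightarrow> nat" where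
  "variable_prime = (SOME p. inj p \<and> (\<forall>i. prime (p i)))"

lemma variable_prime: "inj (variable_prime :: 'n::finite \<Rightarrow> nat)" "prime (variable_prime (i :: 'n))"
proof -
  obtain P :: "nat set" where P: "P \<subseteq> {p. prime p}" "finite P" "card P = CARD('n)"
    using infinite_arbitrarily_large[OF primes_infinite, of "CARD('n)"] by auto
  then obtain p :: "'n \<Rightarrow> nat" where "bij_betw p UNIV P"
    using finite_same_card_bij[of "UNIV :: 'n set" P] by auto
  then have "inj p \<and> (\<forall>i. prime (p i))"
    using P by (auto simp: bij_betw_def)
  then have "inj (variable_prime :: 'n \<Rightarrow> nat) \<and> (\<forall>i :: 'n. prime (variable_prime i))"
    unfolding variable_prime_def by (rule someI[of "\<lambda>p. inj p \<and> (\<forall>i. prime (p i))"])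
  then show "inj (variable_prime :: 'n \<Rightarrow> nat)" "prime (variable_prime i)"
    by auto
qed

definition weight :: "('n::finite \<Rightarrow> nat) \<Rightarrow> nat" where
  "weight \<alpha> = (\<Prod>i\<in>UNIV. variable_prime i ^ \<alpha> i)"

lemma weight_add: "weight (\<alpha> + \<beta>) = weight \<alpha> * weight \<beta>"
  by (simp add: weight_def power_add prod.distrib)

lemma variable_prime_pos [simp]: "0 < variable_prime i"
  by (simp add: prime_gt_0_nat variable_prime(2))

lemma weight_pos [simp]: "0 < weight \<alpha>"
  unfolding weight_def by (intro prod_pos) auto

lemma weight_neq_0 [simp]: "weight \<alpha> \<noteq> 0"
  using weight_pos[of \<alpha>] by simp

text \<open>Unique factorization: the exponent of the \<open>j\<close>-th variable is the multiplicity of its prime.\<close>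

lemma inj_weight: "inj (weight :: ('n::finite \<Rightarrow> nat) \<Rightarrow> nat)"
proof (rule injI)
  fix \<alpha> \<beta> :: "'n \<Rightarrow> nat" assume eq: "weight \<alpha> = weight \<beta>"
  have "multiplicity (variable_prime j) (weight \<gamma>) = \<gamma> j" for j and \<gamma> :: "'n \<Rightarrow> nat"
  proof -
    let ?q = "inv_into UNIV (variable_prime :: 'n \<Rightarrow> nat)"
    have q: "?q (variable_prime i) = i" for i
      by (simp add: variable_prime(1))
    have "weight \<gamma> = (\<Prod>p\<in>range (variable_prime :: 'n \<Rightarrow> nat). p ^ \<gamma> (?q p))"
      by (simp add: weight_def prod.reindex variable_prime(1) q)
    also have "multiplicity (variable_prime j) \<dots> = \<gamma> (?q (variable_prime j))"
      by (subst multiplicity_prod_prime_powers) (auto simp: variable_prime(2))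
    finally show ?thesis by (simp add: q)
  qed
  then show "\<alpha> = \<beta>"
    using eq by (metis ext)
qed

lemma finite_weight_le: "finite {\<alpha> :: 'n::finite \<Rightarrow> nat. weight \<alpha> \<le> N}"
  by (rule finite_imageD[OF finite_subset[of _ "{..N}"]])
    (auto intro: inj_on_subset[OF inj_weight])

text \<open>By injectivity of the weight this is part of the series of the inverse squares.\<close>

lemma weight_summable: "(\<lambda>\<alpha> :: 'n::finite \<Rightarrow> nat. 1 / real (weight \<alpha>) ^ 2) summable_on UNIV"
proof -
  have "(\<lambda>n. 1 / real n ^ 2) summable_on (UNIV :: nat set)"
    using inverse_power_summable[of 2, where 'a = real]
    by (intro summable_nonneg_imp_summable_on) (simp_all add: field_simps)
  then have "(\<lambda>n. 1 / real n ^ 2) summable_on range (weight :: ('n \<Rightarrow> nat) \<Rightarrow> nat)"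
    by (rule summable_on_subset_banach) auto
  then show ?thesis
    by (subst (asm) summable_on_reindex[OF inj_weight]) (simp add: o_def)
qed

section \<open>Convergent power series\<close>

text \<open>The domain of convergence is an unspecified neighbourhood of the origin, because only germs matter.\<close>

definition represents :: "(('n \<Rightarrow> nat) \<Rightarrow> complex) \<Rightarrow> (complex ^ 'n \<Rightarrow> complex) \<Rightarrow> bool" where
  "represents c f \<longleftrightarrow> (\<forall>\<^sub>F x in nhds 0. ((\<lambda>\<alpha>. c \<alpha> * monomial_at x \<alpha>) has_sum f x) UNIV)"

text \<open>This is Cauchy's estimate on a polydisc with radii \<open>1 / p\<^sub>i ^ s\<close>; growing \<open>s\<close> means shrinking radii.\<close>

definition polynomial_growth :: "(('n::finite \<Rightarrow> nat) \<Rightarrow> complex) \<Rightarrow> bool" where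
  "polynomial_growth c \<longleftrightarrow> (\<exists>K s. \<forall>\<alpha>. cmod (c \<alpha>) \<le> K * real (weight \<alpha>) ^ s)"

definition polydisc :: "nat \<Rightarrow> (complex ^ 'n) set" where
  "polydisc s = {x. \<forall>i. cmod (x $ i) < 1 / real (variable_prime i) ^ s}"

lemma prod_inverse_weight:
  "(\<Prod>i\<in>UNIV. (1 / real (variable_prime i) ^ s) ^ \<alpha> i) = 1 / real (weight \<alpha>) ^ s"
proof -
  have "(1 / real (variable_prime i) ^ s) ^ \<alpha> i = 1 / (real (variable_prime i) ^ \<alpha> i) ^ s" for i
    unfolding power_divide power_one power_mult[symmetric] by (simp only: mult.commute)
  then show ?thesis
    by (simp add: prod_dividef weight_def prod_power_distrib)
qed

lemma monomial_at_polydisc: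
  assumes "x \<in> polydisc s"
  shows "cmod (monomial_at x \<alpha>) \<le> 1 / real (weight \<alpha>) ^ s"
proof -
  have x: "cmod (x $ i) \<le> 1 / real (variable_prime i) ^ s" for i
    using assms unfolding polydisc_def by (simp add: less_le)
  have "cmod (monomial_at x \<alpha>) \<le> (\<Prod>i\<in>UNIV. (1 / real (variable_prime i) ^ s) ^ \<alpha> i)"
    unfolding monomial_at_def prod_norm[symmetric] norm_power
    by (intro prod_mono conjI power_mono x norm_ge_zero zero_le_power)
  also have "\<dots> = 1 / real (weight \<alpha>) ^ s"
    by (rule prod_inverse_weight)
  finally show ?thesis .
qed

lemma eventually_polydisc: "\<forall>\<^sub>F x in nhds 0. x \<in> polydisc s"
proof -
  have "\<forall>\<^sub>F x in nhds (0 :: complex ^ 'n). cmod (x $ i) < 1 / real (variable_prime i) ^ s" for i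
  proof (rule order_tendstoD)
    show "((\<lambda>x :: complex ^ 'n. cmod (x $ i)) \<longlongrightarrow> 0) (nhds 0)"
      by (rule tendsto_eq_intros filterlim_ident | simp)+
  qed simp
  then show ?thesis
    unfolding polydisc_def mem_Collect_eq by (rule eventually_all_finite)
qed

text \<open>On \<open>polydisc (s + 2)\<close> a monomial compensates the growth of its coefficient, with two powers of the
weight left over; by \<open>weight_summable\<close> this is a summable bound.\<close>

lemma norm_summand_le:
  assumes c: "\<And>\<alpha>. cmod (c \<alpha>) \<le> K * real (weight \<alpha>) ^ s" and x: "x \<in> polydisc (s + 2)"
  shows "cmod (c \<alpha> * monomial_at x \<alpha>) \<le> K * (1 / real (weight \<alpha>) ^ 2)"
proof -
  have "cmod (c \<alpha> * monomial_at x \<alpha>) \<le> (K * real (weight \<alpha>) ^ s) * (1 / real (weight \<alpha>) ^ (s + 2))"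
    unfolding norm_mult using c[of \<alpha>] order_trans[OF norm_ge_zero c[of \<alpha>]]
    by (intro mult_mono monomial_at_polydisc[OF x]) auto
  also have "\<dots> = K * (1 / real (weight \<alpha>) ^ 2)"
    by (simp add: power_add power2_eq_square)
  finally show ?thesis .
qed

text \<open>The points with coordinates \<open>1 / p\<^sub>i ^ s\<close> tend to the origin, so the series converges absolutely at one
of them, and the summands there are \<open>c \<alpha> / weight \<alpha> ^ s\<close> up to a phase.\<close>

lemma represents_imp_polynomial_growth:
  fixes f :: "complex ^ 'n \<Rightarrow> complex"
  assumes "represents c f"
  shows "polynomial_growth c"
proof -
  define X :: "nat \<Rightarrow> complex ^ 'n" where
    "X s = (\<chi> i. of_real (1 / real (variable_prime i) ^ s))" for s
  have "(\<lambda>s. X s $ i) \<longlonglongrightarrow> 0" for i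
  proof -
    have "1 < real (variable_prime i)"
      using prime_gt_1_nat[OF variable_prime(2)[of i]] by simp
    then have "(\<lambda>s. 1 / real (variable_prime i) ^ s) \<longlonglongrightarrow> 0"
      using LIMSEQ_realpow_zero[of "1 / real (variable_prime i)"] by (simp add: power_one_over)
    from tendsto_of_real[OF this, where 'a = complex] show ?thesis
      by (simp add: X_def)
  qed
  then have "X \<longlonglongrightarrow> 0"
    by (intro vec_tendstoI) auto
  from eventually_compose_filterlim[OF assms[unfolded represents_def] this]
  have "\<forall>\<^sub>F s in sequentially. ((\<lambda>\<alpha>. c \<alpha> * monomial_at (X s) \<alpha>) has_sum f (X s)) UNIV" .
  then obtain s where s: "((\<lambda>\<alpha>. c \<alpha> * monomial_at (X s) \<alpha>) has_sum f (X s)) UNIV"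
    unfolding eventually_sequentially by blast
  have X: "cmod (monomial_at (X s) \<alpha>) = 1 / real (weight \<alpha>) ^ s" for \<alpha>
    using prod_inverse_weight[of s \<alpha>]
    by (simp add: monomial_at_def X_def norm_power norm_divide flip: prod_norm)
  define T where "T \<alpha> = cmod (c \<alpha> * monomial_at (X s) \<alpha>)" for \<alpha>
  have T: "T summable_on UNIV"
    unfolding T_def
    by (rule summable_on_iff_abs_summable_on_complex[THEN iffD1, OF has_sum_imp_summable[OF s]])
  have "cmod (c \<alpha>) \<le> infsum T UNIV * real (weight \<alpha>) ^ s" for \<alpha>
  proof -
    have "T \<alpha> \<le> infsum T UNIV"
      using finite_sum_le_infsum[OF T, of "{\<alpha>}"] by (simp add: T_def)
    then have "cmod (c \<alpha>) / real (weight \<alpha>) ^ s \<le> infsum T UNIV"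
      by (simp add: T_def norm_mult X)
    then show ?thesis
      by (simp add: pos_divide_le_eq)
  qed
  then show ?thesis
    unfolding polynomial_growth_def by blast
qed

lemma polynomial_growth_imp_represents:
  fixes c :: "('n::finite \<Rightarrow> nat) \<Rightarrow> complex"
  assumes "polynomial_growth c"
  obtains f where "represents c f"
proof -
  obtain K s where Ks: "\<And>\<alpha>. cmod (c \<alpha>) \<le> K * real (weight \<alpha>) ^ s"
    using assms unfolding polynomial_growth_def by blast
  define f where "f x = infsum (\<lambda>\<alpha>. c \<alpha> * monomial_at x \<alpha>) UNIV" for x
  have f: "((\<lambda>\<alpha>. c \<alpha> * monomial_at x \<alpha>) has_sum f x) UNIV" if x: "x \<in> polydisc (s + 2)" for x
  proof -
    have "(\<lambda>\<alpha> :: 'n \<Rightarrow> nat. K * (1 / real (weight \<alpha>) ^ 2)) summable_on UNIV"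
      by (rule summable_on_cmult_right[OF weight_summable])
    then have "(\<lambda>\<alpha>. cmod (c \<alpha> * monomial_at x \<alpha>)) summable_on UNIV"
      by (rule Infinite_Sum.abs_summable_on_comparison_test') (rule norm_summand_le[OF Ks x])
    then show ?thesis
      unfolding f_def by (rule has_sum_infsum[OF abs_summable_summable])
  qed
  have "represents c f"
    unfolding represents_def by (rule eventually_mono[OF eventually_polydisc[of "s + 2"] f])
  then show thesis by (rule that)
qed

lemma continuous_monomial_at: "continuous_on A (\<lambda>x. monomial_at x \<alpha>)"
  unfolding monomial_at_def by (intro continuous_intros)

text \<open>The bound by inverse squares of the weight is uniform on the polydisc, so the Weierstrass test applies.\<close>

lemma represents_imp_continuous:
  fixes f :: "complex ^ 'n \<Rightarrow> complex"
  assumes "represents c f"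
  obtains U where "open U" "0 \<in> U" "continuous_on U f"
proof -
  obtain K s where Ks: "\<And>\<alpha>. cmod (c \<alpha>) \<le> K * real (weight \<alpha>) ^ s"
    using represents_imp_polynomial_growth[OF assms] unfolding polynomial_growth_def by blast
  have "\<forall>\<^sub>F x in nhds 0. x \<in> polydisc (s + 2) \<and> ((\<lambda>\<alpha>. c \<alpha> * monomial_at x \<alpha>) has_sum f x) UNIV"
    by (rule eventually_conj[OF eventually_polydisc assms[unfolded represents_def]])
  then obtain U :: "(complex ^ 'n) set" where U: "open U" "0 \<in> U" "\<And>x. x \<in> U \<Longrightarrow> x \<in> polydisc (s + 2)"
      "\<And>x. x \<in> U \<Longrightarrow> ((\<lambda>\<alpha>. c \<alpha> * monomial_at x \<alpha>) has_sum f x) UNIV"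
    unfolding eventually_nhds by metis
  have "uniform_limit U (\<lambda>F x. \<Sum>\<alpha>\<in>F. c \<alpha> * monomial_at x \<alpha>)
      (\<lambda>x. infsum (\<lambda>\<alpha>. c \<alpha> * monomial_at x \<alpha>) UNIV) (finite_subsets_at_top UNIV)"
    by (rule Weierstrass_m_test_general[where M = "\<lambda>\<alpha>. K * (1 / real (weight \<alpha>) ^ 2)"])
      (rule norm_summand_le[OF Ks U(3)] summable_on_cmult_right[OF weight_summable]
        | assumption)+
  then have "continuous_on U (\<lambda>x. infsum (\<lambda>\<alpha>. c \<alpha> * monomial_at x \<alpha>) UNIV)"
    by (rule uniform_limit_theorem[rotated])
      (intro always_eventually allI continuous_intros continuous_monomial_at finite_subsets_at_top_neq_bot)+
  moreover have "infsum (\<lambda>\<alpha>. c \<alpha> * monomial_at x \<alpha>) UNIV = f x" if "x \<in> U" for x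
    by (rule infsumI[OF U(4)[OF that]])
  ultimately have "continuous_on U f"
    by (simp cong: continuous_on_cong)
  from that[OF U(1,2) this] show thesis .
qed

lemma finite_antidiagonal: "finite {z. fst z + snd z = (\<gamma> :: 'n::finite \<Rightarrow> nat)}"
proof (rule finite_subset)
  let ?W = "{\<alpha> :: 'n \<Rightarrow> nat. weight \<alpha> \<le> weight \<gamma>}"
  show "{z. fst z + snd z = \<gamma>} \<subseteq> ?W \<times> ?W"
    by (auto simp: weight_add Suc_le_eq)
  show "finite (?W \<times> ?W)"
    by (intro finite_cartesian_product finite_weight_le)
qed

definition cauchy_product ::
    "(('n::finite \<Rightarrow> nat) \<Rightarrow> complex) \<Rightarrow> (('n \<Rightarrow> nat) \<Rightarrow> complex) \<Rightarrow> ('n \<Rightarrow> nat) \<Rightarrow> complex" where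
  "cauchy_product c d \<gamma> = (\<Sum>z | fst z + snd z = \<gamma>. c (fst z) * d (snd z))"

lemma monomial_at_add: "monomial_at x (\<alpha> + \<beta>) = monomial_at x \<alpha> * monomial_at x \<beta>"
  by (simp add: monomial_at_def power_add prod.distrib)

text \<open>The product of two absolutely convergent sums may be grouped by the total exponent \<open>\<gamma>\<close>.\<close>

lemma represents_cauchy_product:
  fixes f g :: "complex ^ 'n \<Rightarrow> complex"
  assumes "represents c f" "represents d g"
  shows "represents (cauchy_product c d) (\<lambda>x. f x * g x)"
proof -
  have sum: "((\<lambda>\<gamma>. cauchy_product c d \<gamma> * monomial_at x \<gamma>) has_sum f x * g x) UNIV"
    if f: "((\<lambda>\<alpha>. c \<alpha> * monomial_at x \<alpha>) has_sum f x) UNIV"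
      and g: "((\<lambda>\<alpha>. d \<alpha> * monomial_at x \<alpha>) has_sum g x) UNIV" for x
  proof -
    define A where "A = (\<lambda>\<gamma> :: 'n \<Rightarrow> nat. {z. fst z + snd z = \<gamma>})"
    define t where "t = (\<lambda>(\<alpha>, \<beta>). (c \<alpha> * monomial_at x \<alpha>) * (d \<beta> * monomial_at x \<beta>))"
    have "bij_betw snd (Sigma UNIV A) UNIV"
      by (auto simp: bij_betw_def inj_on_def A_def image_iff)
    from has_sum_reindex_bij_betw[OF this, of t "f x * g x"]
    have "((\<lambda>w. t (snd w)) has_sum f x * g x) (Sigma UNIV A)"
      using has_sum_mult_complex[OF f g] by (simp add: t_def)
    moreover have "((\<lambda>z. t (snd (\<gamma>, z))) has_sum cauchy_product c d \<gamma> * monomial_at x \<gamma>) (A \<gamma>)" for \<gamma>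
    proof -
      have "sum t (A \<gamma>) = cauchy_product c d \<gamma> * monomial_at x \<gamma>"
        unfolding cauchy_product_def sum_distrib_right A_def
        by (rule sum.cong) (auto simp: t_def monomial_at_add case_prod_unfold mult_ac)
      then show ?thesis
        using has_sum_finite[OF finite_antidiagonal, of t \<gamma>] by (simp add: A_def)
    qed
    ultimately show ?thesis
      by (rule has_sum_SigmaD)
  qed
  show ?thesis
    using assms unfolding represents_def by eventually_elim (rule sum)
qed

lemma represents_add:
  assumes "represents c f" "represents d g"
  shows "represents (\<lambda>\<alpha>. c \<alpha> + d \<alpha>) (\<lambda>x. f x + g x)"
  using assms unfolding represents_def
  by eventually_elim (simp add: distrib_right has_sum_add)

lemma represents_zero: "represents (\<lambda>\<alpha>. 0) (\<lambda>x. 0)"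
  by (simp add: represents_def)

lemma represents_sum:
  assumes "finite B" "\<And>b. b \<in> B \<Longrightarrow> represents (c b) (f b)"
  shows "represents (\<lambda>\<alpha>. \<Sum>b\<in>B. c b \<alpha>) (\<lambda>x. \<Sum>b\<in>B. f b x)"
  using assms by (induction B rule: finite_induct) (simp_all add: represents_zero represents_add)

lemma represents_scale: "represents c f \<Longrightarrow> represents (\<lambda>\<alpha>. k * c \<alpha>) (\<lambda>x. k * f x)"
  unfolding represents_def
  by (erule eventually_mono) (simp add: mult.assoc has_sum_cmult_right)

lemma represents_unique:
  assumes "represents c f" "represents c g"
  shows "\<forall>\<^sub>F x in nhds 0. f x = g x"
  using assms unfolding represents_def by eventually_elim (rule has_sum_unique)

lemma analytic_at_origin_iff_represents: "analytic_at_origin f \<longleftrightarrow> (\<exists>c. represents c f)"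
  by (simp add: analytic_at_origin_def represents_def)

lemma analytic_at_origin_continuous:
  fixes f :: "complex ^ 'n \<Rightarrow> complex"
  assumes "analytic_at_origin f"
  obtains U where "open U" "0 \<in> U" "continuous_on U f"
  using assms represents_imp_continuous analytic_at_origin_iff_represents by metis

lemma analytic_at_origin_tendsto:
  assumes "analytic_at_origin f"
  shows "(f \<longlongrightarrow> f 0) (nhds 0)"
proof -
  obtain U where U: "open U" "0 \<in> U" "continuous_on U f"
    by (rule analytic_at_origin_continuous[OF assms])
  have "(f \<longlongrightarrow> f 0) (at 0)"
    using continuous_on_interior[OF U(3)] U(1,2) by (simp add: interior_open isCont_def)
  then show ?thesis
    using tendsto_at_iff_tendsto_nhds by blast
qed

lemma analytic_at_origin_bounded:
  assumes "analytic_at_origin f"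
  obtains C where "0 \<le> C" "\<forall>\<^sub>F x in nhds 0. cmod (f x) \<le> C"
proof -
  have "((\<lambda>x. cmod (f x)) \<longlongrightarrow> cmod (f 0)) (nhds 0)"
    by (rule tendsto_norm[OF analytic_at_origin_tendsto[OF assms]])
  then have "\<forall>\<^sub>F x in nhds 0. cmod (f x) < cmod (f 0) + 1"
    by (rule order_tendstoD) simp
  then show thesis
    by (intro that[of "cmod (f 0) + 1"]) (auto elim: eventually_mono)
qed

section \<open>Division of power series\<close>

text \<open>Beyond weight \<open>m\<close> the initial monomial dominates: all weights there are at least \<open>m + 1\<close>, so each
further power of \<open>m / weight \<beta>\<close> gains a factor \<open>\<rho> = m / (m + 1) < 1\<close> uniformly in \<open>\<beta>\<close>.\<close>

lemma tail_eventually_small: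
  fixes c :: "('n::finite \<Rightarrow> nat) \<Rightarrow> complex"
  assumes "polynomial_growth c" "0 < m" "0 < \<epsilon>"
  shows "\<forall>\<^sub>F s in sequentially. \<forall>A. finite A \<and> (\<forall>\<beta>\<in>A. m < weight \<beta>) \<longrightarrow>
    (\<Sum>\<beta>\<in>A. cmod (c \<beta>) * (real m / real (weight \<beta>)) ^ s) \<le> \<epsilon>"
proof -
  obtain K t where Kt: "\<And>\<alpha>. cmod (c \<alpha>) \<le> K * real (weight \<alpha>) ^ t"
    using assms(1) unfolding polynomial_growth_def by blast
  have "0 \<le> K * real (weight (\<lambda>_ :: 'n. 0)) ^ t"
    by (rule order_trans[OF norm_ge_zero Kt])
  then have K: "0 \<le> K"
    by (simp add: weight_def)
  define S where "S = (\<Sum>\<^sub>\<infinity>\<alpha> :: 'n \<Rightarrow> nat. 1 / real (weight \<alpha>) ^ 2)"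
  define \<rho> where "\<rho> = real m / (real m + 1)"
  have \<rho>: "0 \<le> \<rho>" "\<rho> < 1"
    by (auto simp: \<rho>_def)
  define D where "D = K * real m ^ (t + 2)"
  have D: "0 \<le> D"
    using K by (simp add: D_def)
  have tail: "cmod (c \<beta>) * (real m / real (weight \<beta>)) ^ (k + (t + 2)) \<le> D * \<rho> ^ k * (1 / real (weight \<beta>) ^ 2)"
    if "m < weight \<beta>" for k \<beta>
  proof -
    have le: "real m / real (weight \<beta>) \<le> \<rho>"
      unfolding \<rho>_def using that assms(2) by (intro divide_left_mono) auto
    have "cmod (c \<beta>) * (real m / real (weight \<beta>)) ^ (k + (t + 2))
        = (cmod (c \<beta>) * (real m / real (weight \<beta>)) ^ (t + 2)) * (real m / real (weight \<beta>)) ^ k"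
      by (simp only: power_add mult_ac)
    also have "\<dots> \<le> (K * real (weight \<beta>) ^ t * (real m / real (weight \<beta>)) ^ (t + 2)) * \<rho> ^ k"
      using Kt[of \<beta>] le K by (intro mult_mono power_mono mult_right_mono) auto
    also have "\<dots> = D * \<rho> ^ k * (1 / real (weight \<beta>) ^ 2)"
      by (simp add: D_def power_divide power_add power2_eq_square)
    finally show ?thesis .
  qed
  have sum: "(\<Sum>\<beta>\<in>A. cmod (c \<beta>) * (real m / real (weight \<beta>)) ^ (k + (t + 2))) \<le> D * \<rho> ^ k * S"
    if "finite A" "\<forall>\<beta>\<in>A. m < weight \<beta>" for A k
  proof -
    have "(\<Sum>\<beta>\<in>A. cmod (c \<beta>) * (real m / real (weight \<beta>)) ^ (k + (t + 2)))
        \<le> (\<Sum>\<beta>\<in>A. D * \<rho> ^ k * (1 / real (weight \<beta>) ^ 2))"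
      using that(2) by (intro sum_mono tail) auto
    also have "\<dots> = D * \<rho> ^ k * (\<Sum>\<beta>\<in>A. 1 / real (weight \<beta>) ^ 2)"
      by (simp only: sum_distrib_left)
    also have "\<dots> \<le> D * \<rho> ^ k * S"
      unfolding S_def using D \<rho>(1) that(1)
      by (intro mult_left_mono finite_sum_le_infsum[OF weight_summable]) auto
    finally show ?thesis .
  qed
  have "(\<lambda>k. D * \<rho> ^ k * S) \<longlonglongrightarrow> D * 0 * S"
    by (intro tendsto_intros LIMSEQ_realpow_zero \<rho>)
  then have "\<forall>\<^sub>F k in sequentially. D * \<rho> ^ k * S < \<epsilon>"
    using assms(3) by (simp add: order_tendstoD)
  then have "\<forall>\<^sub>F k in sequentially. \<forall>A. finite A \<and> (\<forall>\<beta>\<in>A. m < weight \<beta>) \<longrightarrow>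
    (\<Sum>\<beta>\<in>A. cmod (c \<beta>) * (real m / real (weight \<beta>)) ^ (k + (t + 2))) \<le> \<epsilon>"
  proof (rule eventually_mono, intro allI impI, elim conjE)
    fix k and A :: "('n \<Rightarrow> nat) set"
    assume "D * \<rho> ^ k * S < \<epsilon>" "finite A" "\<forall>\<beta>\<in>A. m < weight \<beta>"
    with sum[of A k] show "(\<Sum>\<beta>\<in>A. cmod (c \<beta>) * (real m / real (weight \<beta>)) ^ (k + (t + 2))) \<le> \<epsilon>"
      by linarith
  qed
  then show ?thesis
    by (rule eventually_sequentially_seg[THEN iffD1])
qed

text \<open>The series \<open>h\<close> whose part with \<open>\<sigma> \<gamma> = b\<close> is \<open>x\<^sup>b\<close> times the quotient by \<open>p b\<close>, and whose remaining
part is the remainder. The map \<open>\<sigma>\<close> assigns to a monomial divisible by some \<open>b \<in> B\<close> the divisor that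
takes care of it. The equation \<open>g = \<Sum>b. q\<^sub>b p\<^sub>b + r\<close> determines \<open>h \<gamma>\<close> by the values of \<open>h\<close> at smaller
weights, because every monomial of \<open>p b\<close> other than the initial one has a weight larger than \<open>b\<close>.\<close>

function division_series :: "(('n::finite \<Rightarrow> nat) \<Rightarrow> complex) \<Rightarrow> (('n \<Rightarrow> nat) \<Rightarrow> ('n \<Rightarrow> nat) \<Rightarrow> complex) \<Rightarrow>
    ('n \<Rightarrow> nat) set \<Rightarrow> (('n \<Rightarrow> nat) \<Rightarrow> ('n \<Rightarrow> nat)) \<Rightarrow> ('n \<Rightarrow> nat) \<Rightarrow> complex" where
  "division_series g p B \<sigma> \<gamma> = g \<gamma> - (\<Sum>b\<in>B. \<Sum>z | fst z + snd z = \<gamma> \<and> weight b < weight (snd z).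
      (if \<sigma> (fst z + b) = b then division_series g p B \<sigma> (fst z + b) else 0) * p b (snd z))"
  by pat_completeness auto
termination
  by (relation "Wellfounded.measure (\<lambda>(g, p, B, \<sigma>, \<gamma>). weight \<gamma>)") (auto simp: weight_add)

declare division_series.simps [simp del]

text \<open>If \<open>|h| \<le> 2 K weight ^ s\<close> holds below \<open>\<gamma>\<close>, then by multiplicativity of the weight the recursive
sum at \<open>\<gamma>\<close> is at most \<open>2 K weight \<gamma> ^ s\<close> times the tails of the divisors, which for large \<open>s\<close> add up to at
most \<open>1/2\<close>. The other half is left for \<open>g \<gamma>\<close>.\<close>

lemma polynomial_growth_division_series:
  fixes g :: "('n::finite \<Rightarrow> nat) \<Rightarrow> complex"
  assumes B: "finite B" and p: "\<And>b. b \<in> B \<Longrightarrow> polynomial_growth (p b)" and g: "polynomial_growth g"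
  shows "polynomial_growth (division_series g p B \<sigma>)"
proof -
  obtain K t where Kt: "\<And>\<alpha>. cmod (g \<alpha>) \<le> K * real (weight \<alpha>) ^ t"
    using g unfolding polynomial_growth_def by blast
  have "0 \<le> K * real (weight (\<lambda>_ :: 'n. 0)) ^ t"
    by (rule order_trans[OF norm_ge_zero Kt])
  then have K: "0 \<le> K"
    by (simp add: weight_def)
  \<comment> \<open>the tails of all divisors together may use up half of the bound; adding \<open>1\<close> covers an empty \<open>B\<close>\<close>
  define \<epsilon> where "\<epsilon> = 1 / (2 * (real (card B) + 1))"
  have \<epsilon>: "0 < \<epsilon>" "real (card B) * \<epsilon> \<le> 1 / 2"
    by (simp_all add: \<epsilon>_def pos_divide_le_eq)
  have "\<forall>\<^sub>F s in sequentially. t \<le> s \<and> (\<forall>b\<in>B. \<forall>A. finite A \<and> (\<forall>\<beta>\<in>A. weight b < weight \<beta>) \<longrightarrow>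
      (\<Sum>\<beta>\<in>A. cmod (p b \<beta>) * (real (weight b) / real (weight \<beta>)) ^ s) \<le> \<epsilon>)"
  proof (rule eventually_conj[OF eventually_ge_at_top eventually_ball_finite[OF B]], rule ballI)
    show "\<forall>\<^sub>F s in sequentially. \<forall>A. finite A \<and> (\<forall>\<beta>\<in>A. weight b < weight \<beta>) \<longrightarrow>
        (\<Sum>\<beta>\<in>A. cmod (p b \<beta>) * (real (weight b) / real (weight \<beta>)) ^ s) \<le> \<epsilon>" if "b \<in> B" for b
      by (rule tail_eventually_small[OF p[OF that] weight_pos \<epsilon>(1)])
  qed
  from eventually_happens'[OF sequentially_bot this]
  obtain s where "t \<le> s \<and> (\<forall>b\<in>B. \<forall>A. finite A \<and> (\<forall>\<beta>\<in>A. weight b < weight \<beta>) \<longrightarrow>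
      (\<Sum>\<beta>\<in>A. cmod (p b \<beta>) * (real (weight b) / real (weight \<beta>)) ^ s) \<le> \<epsilon>)"
    by (rule exE)
  then have s: "t \<le> s" "\<And>b A. b \<in> B \<Longrightarrow> finite A \<Longrightarrow> (\<forall>\<beta>\<in>A. weight b < weight \<beta>) \<Longrightarrow>
      (\<Sum>\<beta>\<in>A. cmod (p b \<beta>) * (real (weight b) / real (weight \<beta>)) ^ s) \<le> \<epsilon>"
    by auto
  have "cmod (division_series g p B \<sigma> \<gamma>) \<le> 2 * K * real (weight \<gamma>) ^ s" for \<gamma>
  proof (induction \<gamma> rule: measure_induct_rule[of weight])
    case (less \<gamma>)
    define h where "h = division_series g p B \<sigma>"
    define M where "M = 2 * K * real (weight \<gamma>) ^ s"
    have M: "0 \<le> M"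
      using K by (simp add: M_def)
    define X where "X b = {z. fst z + snd z = \<gamma> \<and> weight b < weight (snd z)}" for b :: "'n \<Rightarrow> nat"
    have fin: "finite (X b)" for b
      by (rule finite_subset[OF _ finite_antidiagonal[of \<gamma>]]) (auto simp: X_def)
    have summand: "cmod ((if \<sigma> (fst z + b) = b then h (fst z + b) else 0) * p b (snd z))
        \<le> M * (cmod (p b (snd z)) * (real (weight b) / real (weight (snd z))) ^ s)"
      if z: "z \<in> X b" for b z
    proof -
      have w: "weight \<gamma> = weight (fst z) * weight (snd z)" "weight b < weight (snd z)"
        using z by (auto simp: X_def weight_add)
      then have "weight (fst z + b) < weight \<gamma>"
        unfolding w(1) weight_add by (simp only: mult_less_cancel1 weight_pos)
      then have "cmod (h (fst z + b)) \<le> 2 * K * real (weight (fst z + b)) ^ s"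
        unfolding h_def by (rule less.IH)
      also have "real (weight (fst z + b)) = real (weight \<gamma>) * (real (weight b) / real (weight (snd z)))"
        by (simp add: w(1) weight_add)
      also have "2 * K * \<dots> ^ s = M * (real (weight b) / real (weight (snd z))) ^ s"
        by (simp only: M_def power_mult_distrib mult.assoc)
      finally have "cmod (h (fst z + b)) \<le> M * (real (weight b) / real (weight (snd z))) ^ s" .
      then have "cmod (if \<sigma> (fst z + b) = b then h (fst z + b) else 0)
          \<le> M * (real (weight b) / real (weight (snd z))) ^ s"
        using M by simp
      from mult_right_mono[OF this norm_ge_zero[of "p b (snd z)"]] show ?thesis
        unfolding norm_mult by (simp only: mult.assoc mult.commute[of "cmod (p b (snd z))"])
    qed
    have row: "(\<Sum>z\<in>X b. M * (cmod (p b (snd z)) * (real (weight b) / real (weight (snd z))) ^ s)) \<le> M * \<epsilon>"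
      if "b \<in> B" for b
    proof -
      have "inj_on snd (X b)"
        by (auto simp: inj_on_def X_def)
      then have "(\<Sum>z\<in>X b. cmod (p b (snd z)) * (real (weight b) / real (weight (snd z))) ^ s)
          = (\<Sum>\<beta>\<in>snd ` X b. cmod (p b \<beta>) * (real (weight b) / real (weight \<beta>)) ^ s)"
        by (simp add: sum.reindex)
      also have "\<dots> \<le> \<epsilon>"
        by (rule s(2)[OF that]) (auto simp: X_def fin[unfolded X_def])
      finally show ?thesis
        unfolding sum_distrib_left[symmetric] using M by (rule mult_left_mono)
    qed
    have "cmod (h \<gamma>) \<le> cmod (g \<gamma>) + (\<Sum>b\<in>B. M * \<epsilon>)"
    proof -
      define T where "T b = (\<Sum>z\<in>X b. (if \<sigma> (fst z + b) = b then h (fst z + b) else 0) * p b (snd z))" for b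
      have T: "cmod (T b) \<le> M * \<epsilon>" if "b \<in> B" for b
        unfolding T_def by (rule order_trans[OF sum_norm_le[OF summand] row[OF that]])
      have "h \<gamma> = g \<gamma> - (\<Sum>b\<in>B. T b)"
        unfolding h_def X_def T_def by (rule division_series.simps)
      then have "cmod (h \<gamma>) \<le> cmod (g \<gamma>) + cmod (\<Sum>b\<in>B. T b)"
        using norm_triangle_ineq4[of "g \<gamma>" "\<Sum>b\<in>B. T b"] by simp
      also have "cmod (\<Sum>b\<in>B. T b) \<le> (\<Sum>b\<in>B. M * \<epsilon>)"
        by (rule sum_norm_le[OF T])
      finally show ?thesis
        by simp
    qed
    also have "cmod (g \<gamma>) \<le> M / 2"
    proof -
      have "K * real (weight \<gamma>) ^ t \<le> K * real (weight \<gamma>) ^ s"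
        using K s(1) by (intro mult_left_mono power_increasing) (auto simp: Suc_le_eq)
      then show ?thesis
        using Kt[of \<gamma>] by (simp add: M_def)
    qed
    also have "(\<Sum>b\<in>B. M * \<epsilon>) \<le> M * (1 / 2)"
      using mult_left_mono[OF \<epsilon>(2) M] by (simp add: mult.left_commute)
    finally show ?case
      by (simp add: h_def M_def)
  qed
  then show ?thesis
    unfolding polynomial_growth_def by blast
qed

text \<open>In the Cauchy product with \<open>p b\<close>, the monomials of \<open>p b\<close> below \<open>b\<close> contribute nothing, those above
\<open>b\<close> are what the recursion subtracts, and \<open>b\<close> itself gives back \<open>h \<gamma>\<close> for exactly one \<open>b\<close>,
namely \<open>\<sigma> \<gamma>\<close>, if \<open>\<gamma>\<close> is divisible at all.\<close>

lemma division_series_identity: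
  fixes g :: "('n::finite \<Rightarrow> nat) \<Rightarrow> complex"
  assumes B: "finite B" and lead: "\<And>b. b \<in> B \<Longrightarrow> p b b = 1"
    and low: "\<And>b \<beta>. b \<in> B \<Longrightarrow> weight \<beta> < weight b \<Longrightarrow> p b \<beta> = 0"
    and \<sigma>: "\<And>\<alpha> b. b \<in> B \<Longrightarrow> \<sigma> (\<alpha> + b) \<in> B \<and> (\<exists>\<alpha>'. \<alpha> + b = \<alpha>' + \<sigma> (\<alpha> + b))"
  defines "h \<equiv> division_series g p B \<sigma>"
  shows "g \<gamma> = (\<Sum>b\<in>B. cauchy_product (\<lambda>\<alpha>. if \<sigma> (\<alpha> + b) = b then h (\<alpha> + b) else 0) (p b) \<gamma>)
    + (if \<exists>b\<in>B. \<exists>\<alpha>. \<gamma> = \<alpha> + b then 0 else h \<gamma>)"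
proof -
  define q where "q b = (\<lambda>\<alpha>. if \<sigma> (\<alpha> + b) = b then h (\<alpha> + b) else 0)" for b
  define X where "X b = {z. fst z + snd z = \<gamma> \<and> weight b < weight (snd z)}" for b :: "'n \<Rightarrow> nat"
  define Y where "Y b = {z. fst z + snd z = \<gamma> \<and> snd z = b}" for b :: "'n \<Rightarrow> nat"
  have fin: "finite (X b)" "finite (Y b)" for b
    by (rule finite_subset[OF _ finite_antidiagonal[of \<gamma>]]; auto simp: X_def Y_def)+
  have split: "cauchy_product (q b) (p b) \<gamma>
      = (\<Sum>z\<in>X b. q b (fst z) * p b (snd z)) + (\<Sum>z\<in>Y b. q b (fst z) * p b (snd z))" if "b \<in> B" for b
  proof -
    have "cauchy_product (q b) (p b) \<gamma> = (\<Sum>z\<in>X b \<union> Y b. q b (fst z) * p b (snd z))"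
      unfolding cauchy_product_def
    proof (rule sum.mono_neutral_right[OF finite_antidiagonal])
      show "\<forall>z\<in>{z. fst z + snd z = \<gamma>} - (X b \<union> Y b). q b (fst z) * p b (snd z) = 0"
      proof
        fix z assume z: "z \<in> {z. fst z + snd z = \<gamma>} - (X b \<union> Y b)"
        then have "weight (snd z) \<le> weight b" "weight (snd z) \<noteq> weight b"
          by (auto simp: X_def Y_def dest: injD[OF inj_weight])
        then show "q b (fst z) * p b (snd z) = 0"
          using low[OF that, of "snd z"] by simp
      qed
    qed (auto simp: X_def Y_def)
    also have "\<dots> = (\<Sum>z\<in>X b. q b (fst z) * p b (snd z)) + (\<Sum>z\<in>Y b. q b (fst z) * p b (snd z))"
      by (rule sum.union_disjoint[OF fin]) (auto simp: X_def Y_def)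
    finally show ?thesis .
  qed
  have diag: "(\<Sum>z\<in>Y b. q b (fst z) * p b (snd z))
      = (if (\<exists>\<alpha>. \<gamma> = \<alpha> + b) \<and> \<sigma> \<gamma> = b then h \<gamma> else 0)" if "b \<in> B" for b
  proof (cases "\<exists>\<alpha>. \<gamma> = \<alpha> + b")
    case True
    then obtain \<alpha> where \<alpha>: "\<gamma> = \<alpha> + b" by blast
    then have "Y b = {(\<alpha>, b)}"
      by (auto simp: Y_def)
    then show ?thesis
      using \<alpha> lead[OF that] by (auto simp: q_def)
  next
    case False
    then have "Y b = {}"
      by (auto simp: Y_def)
    with False show ?thesis
      by simp
  qed
  have "(\<Sum>b\<in>B. if (\<exists>\<alpha>. \<gamma> = \<alpha> + b) \<and> \<sigma> \<gamma> = b then h \<gamma> else 0)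
      = (if \<exists>b\<in>B. \<exists>\<alpha>. \<gamma> = \<alpha> + b then h \<gamma> else 0)"
  proof (cases "\<exists>b\<in>B. \<exists>\<alpha>. \<gamma> = \<alpha> + b")
    case True
    then have \<sigma>\<gamma>: "\<sigma> \<gamma> \<in> B" "\<exists>\<alpha>. \<gamma> = \<alpha> + \<sigma> \<gamma>"
      using \<sigma> by blast+
    then have "((\<exists>\<alpha>. \<gamma> = \<alpha> + b) \<and> \<sigma> \<gamma> = b) \<longleftrightarrow> b = \<sigma> \<gamma>" for b
      by metis
    with True \<sigma>\<gamma>(1) show ?thesis
      using B by simp
  next
    case False
    then have "(\<Sum>b\<in>B. if (\<exists>\<alpha>. \<gamma> = \<alpha> + b) \<and> \<sigma> \<gamma> = b then h \<gamma> else 0) = (\<Sum>b\<in>B. 0)"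
      by (intro sum.cong) auto
    with False show ?thesis
      by simp
  qed
  moreover have "h \<gamma> = g \<gamma> - (\<Sum>b\<in>B. \<Sum>z\<in>X b. q b (fst z) * p b (snd z))"
    unfolding h_def X_def q_def by (rule division_series.simps)
  ultimately show ?thesis
    by (simp add: split diag sum.distrib flip: q_def)
qed

section \<open>Dickson's lemma\<close>

text \<open>A monotone subsequence exists in any linear order; a decreasing one of natural numbers is constant
from its minimum on.\<close>

lemma incseq_subsequence:
  fixes f :: "nat \<Rightarrow> nat"
  obtains r :: "nat \<Rightarrow> nat" where "strict_mono r" "incseq (\<lambda>k. f (r k))"
proof -
  obtain r :: "nat \<Rightarrow> nat" where r: "strict_mono r" "monoseq (\<lambda>k. f (r k))"
    using seq_monosub by blast
  then consider "incseq (\<lambda>k. f (r k))" | "decseq (\<lambda>k. f (r k))"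
    unfolding monoseq_iff by blast
  then show thesis
  proof cases
    case 1
    with r(1) show thesis by (rule that)
  next
    case 2
    obtain N where N: "\<And>k. f (r N) \<le> f (r k)"
      using ex_has_least_nat[of "\<lambda>_. True" 0 "\<lambda>k. f (r k)"] by auto
    have "f (r (N + k)) = f (r N)" for k
      using N[of "N + k"] decseqD[OF 2, of N "N + k"] by simp
    then have "incseq (\<lambda>k. f (r (N + k)))"
      by (simp add: mono_def)
    moreover have "strict_mono (\<lambda>k. r (N + k))"
      using r(1) by (simp add: strict_mono_def)
    ultimately show thesis
      by (intro that[of "\<lambda>k. r (N + k)"])
  qed
qed

lemma incseq_subsequence_exponents:
  fixes f :: "nat \<Rightarrow> 'n::finite \<Rightarrow> nat"
  obtains r :: "nat \<Rightarrow> nat" where "strict_mono r" "incseq (\<lambda>k. f (r k))"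
proof -
  have "\<exists>r :: nat \<Rightarrow> nat. strict_mono r \<and> (\<forall>i\<in>S. incseq (\<lambda>k. f (r k) i))" if "finite S" for S
    using that
  proof (induction S rule: finite_induct)
    case empty
    show ?case
      by (rule exI[of _ id]) (simp add: strict_mono_def)
  next
    case (insert j S)
    then obtain r :: "nat \<Rightarrow> nat" where r: "strict_mono r" "\<forall>i\<in>S. incseq (\<lambda>k. f (r k) i)"
      by blast
    obtain r' :: "nat \<Rightarrow> nat" where r': "strict_mono r'" "incseq (\<lambda>k. f (r (r' k)) j)"
        by (rule incseq_subsequence[of "\<lambda>k. f (r k) j"])
    have "incseq (\<lambda>k. f (r (r' k)) i)" if "i \<in> S" for i
      using r(2) strict_mono_mono[OF r'(1)] that by (simp add: mono_def)
    with r' r(1) show ?case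
      by (intro exI[of _ "\<lambda>k. r (r' k)"]) (simp add: strict_mono_def)
  qed
  from this[of UNIV] obtain r :: "nat \<Rightarrow> nat" where "strict_mono r" "\<forall>i. incseq (\<lambda>k. f (r k) i)"
    by auto
  then show thesis
    by (intro that[of r]) (auto simp: mono_def le_fun_def)
qed

lemma exponent_le_imp_add: "b \<le> e \<Longrightarrow> \<exists>\<alpha>. e = \<alpha> + (b :: 'n \<Rightarrow> nat)"
  by (rule exI[of _ "\<lambda>i. e i - b i"]) (auto simp: le_fun_def)

text \<open>The minimal elements of \<open>E\<close> are finitely many: an infinite sequence of distinct ones would have two
comparable members. Below each element of \<open>E\<close> lies a minimal one, found by minimizing the weight.\<close>

lemma dickson:
  fixes E :: "('n::finite \<Rightarrow> nat) set"
  obtains B where "finite B" "B \<subseteq> E" "\<And>e. e \<in> E \<Longrightarrow> \<exists>b\<in>B. \<exists>\<alpha>. e = \<alpha> + b"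
proof -
  define B where "B = {b \<in> E. \<forall>e\<in>E. e \<le> b \<longrightarrow> e = b}"
  have "finite B"
  proof (rule ccontr)
    assume "infinite B"
    then obtain f :: "nat \<Rightarrow> 'n \<Rightarrow> nat" where f: "inj f" "range f \<subseteq> B"
      using infinite_countable_subset by blast
    obtain r :: "nat \<Rightarrow> nat" where r: "strict_mono r" "incseq (\<lambda>k. f (r k))"
      by (rule incseq_subsequence_exponents)
    have "f (r 0) \<le> f (r 1)"
      using monoD[OF r(2), of 0 1] by simp
    moreover have "f (r 0) \<in> B" "f (r 1) \<in> B"
      using f(2) by blast+
    ultimately have "f (r 0) = f (r 1)"
      unfolding B_def by blast
    then have "r 0 = r 1"
      using f(1) by (simp add: inj_eq)
    then show False
      using strict_monoD[OF r(1), of 0 1] by simp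
  qed
  moreover have "\<exists>b\<in>B. b \<le> e" if "e \<in> E" for e
  proof -
    have "\<exists>b. (b \<in> E \<and> b \<le> e) \<and> (\<forall>a. a \<in> E \<and> a \<le> e \<longrightarrow> weight b \<le> weight a)"
      by (rule ex_has_least_nat[of _ e]) (simp add: that)
    then obtain b where b: "b \<in> E" "b \<le> e" "\<And>a. a \<in> E \<Longrightarrow> a \<le> e \<Longrightarrow> weight b \<le> weight a"
      by blast
    have "a = b" if a: "a \<in> E" "a \<le> b" for a
    proof -
      obtain \<alpha> where \<alpha>: "b = \<alpha> + a"
        using exponent_le_imp_add[OF a(2)] by blast
      have "weight b \<le> weight a"
        by (rule b(3)[OF a(1) order_trans[OF a(2) b(2)]])
      moreover have "weight a \<le> weight b"
        unfolding \<alpha> weight_add by (simp add: Suc_le_eq)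
      ultimately show ?thesis
        by (intro injD[OF inj_weight] antisym)
    qed
    with b(1,2) show ?thesis
      by (auto simp: B_def)
  qed
  moreover have "B \<subseteq> E"
    by (auto simp: B_def)
  ultimately show thesis
    using exponent_le_imp_add by (meson that)
qed

section \<open>The ring of germs is Noetherian\<close>

lemma germ_add:
  assumes "analytic_at_origin f" "analytic_at_origin g"
  shows "germ f \<oplus>\<^bsub>\<O>\<^esub> germ g = germ (\<lambda>x. f x + g x)"
  using ring_hom_add[OF ideal.rcos_ring_hom[OF ideal_vanishing_near_origin], of f g] assms
  by (simp add: germ_def germ_ring_def) (simp add: analytic_functions_def)

lemma germ_mult:
  assumes "analytic_at_origin f" "analytic_at_origin g"
  shows "germ f \<otimes>\<^bsub>\<O>\<^esub> germ g = germ (\<lambda>x. f x * g x)"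
  using ring_hom_mult[OF ideal.rcos_ring_hom[OF ideal_vanishing_near_origin], of f g] assms
  by (simp add: germ_def germ_ring_def) (simp add: analytic_functions_def)

lemma germ_one: "\<one>\<^bsub>\<O>\<^esub> = germ (\<lambda>x :: complex ^ 'n. 1)"
proof -
  have "\<one>\<^bsub>analytic_functions\<^esub> = (\<lambda>x :: complex ^ 'n. 1)"
    by (simp add: analytic_functions_def)
  then show ?thesis
    using ring_hom_one[OF ideal.rcos_ring_hom[OF ideal_vanishing_near_origin]]
    unfolding germ_def germ_ring_def by metis
qed

lemma germ_zero: "\<zero>\<^bsub>\<O>\<^esub> = germ (\<lambda>x :: complex ^ 'n. 0)"
proof -
  interpret ideal "vanishing_near_origin" "analytic_functions :: (complex ^ 'n \<Rightarrow> complex) ring"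
    by (rule ideal_vanishing_near_origin)
  have "vanishing_near_origin = germ (\<lambda>x :: complex ^ 'n. 0)"
    by (auto simp: mem_germ_iff vanishing_near_origin_def)
  then show ?thesis
    by (simp add: germ_ring_def FactRing_def)
qed

lemma germ_in_carrier [simp]: "germ f \<in> carrier \<O>" if "analytic_at_origin f"
  using that by (auto simp: carrier_germ_ring)

lemma ideal_germ_add:
  assumes "ideal I \<O>" "analytic_at_origin f" "analytic_at_origin g" "germ f \<in> I" "germ g \<in> I"
  shows "germ (\<lambda>x. f x + g x) \<in> I"
  using additive_subgroup.a_closed[OF ideal.axioms(1)[OF assms(1)] assms(4,5)]
  by (simp add: germ_add assms(2,3))

lemma ideal_germ_mult:
  assumes "ideal I \<O>" "analytic_at_origin k" "analytic_at_origin f" "germ f \<in> I"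
  shows "germ (\<lambda>x. k x * f x) \<in> I"
  using ideal.I_l_closed[OF assms(1,4) germ_in_carrier[OF assms(2)]]
  by (simp add: germ_mult assms(2,3))

lemma ideal_germ_zero: "ideal I \<O> \<Longrightarrow> germ (\<lambda>x. 0) \<in> I"
  using additive_subgroup.zero_closed[OF ideal.axioms(1)] by (metis germ_zero)

lemma analytic_at_origin_sum:
  assumes "finite B" "\<And>b. b \<in> B \<Longrightarrow> analytic_at_origin (f b)"
  shows "analytic_at_origin (\<lambda>x. \<Sum>b\<in>B. f b x)"
  using assms
  by (induction B rule: finite_induct) (simp_all add: analytic_at_origin_const analytic_at_origin_add)

lemma ideal_germ_sum:
  assumes I: "ideal I \<O>" and "finite B"
    and "\<And>b. b \<in> B \<Longrightarrow> analytic_at_origin (f b)" "\<And>b. b \<in> B \<Longrightarrow> germ (f b) \<in> I"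
  shows "germ (\<lambda>x. \<Sum>b\<in>B. f b x) \<in> I"
  using assms(2-4)
  by (induction B rule: finite_induct)
    (simp_all add: ideal_germ_zero[OF I] ideal_germ_add[OF I] analytic_at_origin_sum)

lemma ideal_generated_by_ideal:
  assumes "\<forall>g\<in>set gs. analytic_at_origin g"
  shows "ideal (ideal_generated_by gs) \<O>" "g \<in> set gs \<Longrightarrow> germ g \<in> ideal_generated_by gs"
proof -
  interpret cring "\<O>"
    by (rule cring_germ_ring)
  have sub: "germ ` set gs \<subseteq> carrier \<O>"
    using assms by auto
  show "ideal (ideal_generated_by gs) \<O>"
    unfolding ideal_generated_by_def by (rule genideal_ideal[OF sub])
  show "germ g \<in> ideal_generated_by gs" if "g \<in> set gs"
    using genideal_self[OF sub] that unfolding ideal_generated_by_def by blast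
qed

lemma ideal_generated_by_minimal:
  assumes "ideal I \<O>" "\<And>g. g \<in> set gs \<Longrightarrow> germ g \<in> I"
  shows "ideal_generated_by gs \<subseteq> I"
proof -
  interpret cring "\<O>"
    by (rule cring_germ_ring)
  show ?thesis
    unfolding ideal_generated_by_def using assms by (intro genideal_minimal) auto
qed

text \<open>Generators are elements whose initial monomials generate all initial monomials of \<open>I\<close>. The remainder of
\<open>g \<in> I\<close> after division by them lies in \<open>I\<close>, and its initial monomial, if there were one, would be
divisible by one of theirs.\<close>

theorem germ_ring_noetherian:
  fixes I :: "(complex ^ 'n \<Rightarrow> complex) set set"
  assumes I: "ideal I \<O>"
  obtains gs where "\<forall>g\<in>set gs. analytic_at_origin g" "I = ideal_generated_by gs"
proof -
  \<comment> \<open>\<open>S\<close> holds the expansions of the elements of \<open>I\<close>, and \<open>E\<close> their initial exponents, the initial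
    coefficient being normalized to \<open>1\<close>\<close>
  define S :: "(('n \<Rightarrow> nat) \<Rightarrow> complex) set" where "S = {c. \<exists>f :: complex ^ 'n \<Rightarrow> complex. represents c f \<and> germ f \<in> I}"
  define E :: "('n \<Rightarrow> nat) set" where "E = {b. \<exists>c\<in>S. c b = 1 \<and> (\<forall>\<beta> :: 'n \<Rightarrow> nat. weight \<beta> < weight b \<longrightarrow> c \<beta> = 0)}"
  obtain B :: "('n \<Rightarrow> nat) set" where B: "finite B" "B \<subseteq> E" "\<And>e. e \<in> E \<Longrightarrow> \<exists>b\<in>B. \<exists>\<alpha>. e = \<alpha> + b"
    using dickson[of E] by metis
  have "\<forall>b\<in>B. \<exists>c f. represents c f \<and> germ f \<in> I \<and> c b = 1 \<and> (\<forall>\<beta>. weight \<beta> < weight b \<longrightarrow> c \<beta> = 0)"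
  proof
    fix b assume "b \<in> B"
    then have "b \<in> E"
      using B(2) by blast
    then show "\<exists>c f. represents c f \<and> germ f \<in> I \<and> c b = 1 \<and> (\<forall>\<beta>. weight \<beta> < weight b \<longrightarrow> c \<beta> = 0)"
      unfolding E_def S_def by blast
  qed
  then obtain p f where pf: "\<And>b. b \<in> B \<Longrightarrow> represents (p b) (f b)"
      "\<And>b. b \<in> B \<Longrightarrow> germ (f b) \<in> I" "\<And>b. b \<in> B \<Longrightarrow> p b b = 1"
      "\<And>b \<beta>. b \<in> B \<Longrightarrow> weight \<beta> < weight b \<Longrightarrow> p b \<beta> = 0"
    unfolding bchoice_iff by auto
  have f_an: "analytic_at_origin (f b)" if "b \<in> B" for b
    using pf(1)[OF that] analytic_at_origin_iff_represents by blast
  obtain bs where bs: "set bs = B"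
    using finite_list[OF B(1)] by blast
  define gs where "gs = map f bs"
  have gs: "\<forall>g\<in>set gs. analytic_at_origin g" "set gs = f ` B"
    by (auto simp: gs_def bs f_an)
  define \<sigma> where "\<sigma> \<gamma> = (SOME b. b \<in> B \<and> (\<exists>\<alpha>. \<gamma> = \<alpha> + b))" for \<gamma> :: "'n \<Rightarrow> nat"
  have \<sigma>: "\<sigma> (\<alpha> + b) \<in> B \<and> (\<exists>\<alpha>'. \<alpha> + b = \<alpha>' + \<sigma> (\<alpha> + b))" if "b \<in> B" for \<alpha> b
    unfolding \<sigma>_def by (rule someI[of "\<lambda>b'. b' \<in> B \<and> (\<exists>\<alpha>'. \<alpha> + b = \<alpha>' + b')" b]) (use that in blast)
  have "u \<in> ideal_generated_by gs" if u: "u \<in> I" for u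
  proof -
    obtain g where g: "u = germ g" "analytic_at_origin g"
      using ideal.Icarr[OF I u] by (auto simp: carrier_germ_ring)
    obtain c where c: "represents c g"
      using g(2) analytic_at_origin_iff_represents by blast
    define h where "h = division_series c p B \<sigma>"
    define q where "q b = (\<lambda>\<alpha>. if \<sigma> (\<alpha> + b) = b then h (\<alpha> + b) else 0)" for b
    define r where "r \<gamma> = (if \<exists>b\<in>B. \<exists>\<alpha>. \<gamma> = \<alpha> + b then 0 else h \<gamma>)" for \<gamma>
    have "polynomial_growth h"
      unfolding h_def
      by (intro polynomial_growth_division_series B(1) represents_imp_polynomial_growth[OF pf(1)]
          represents_imp_polynomial_growth[OF c])
    then obtain K s where Ks: "\<And>\<gamma>. cmod (h \<gamma>) \<le> K * real (weight \<gamma>) ^ s"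
      unfolding polynomial_growth_def by blast
    then have Ks0: "0 \<le> K * real (weight \<gamma>) ^ s" for \<gamma> :: "'n \<Rightarrow> nat"
      using norm_ge_zero order_trans by blast
    have q_growth: "polynomial_growth (q b)" for b
      unfolding polynomial_growth_def
    proof (intro exI allI)
      fix \<alpha>
      have "cmod (q b \<alpha>) \<le> K * real (weight (\<alpha> + b)) ^ s"
        using Ks[of "\<alpha> + b"] Ks0[of "\<alpha> + b"] by (simp add: q_def)
      then show "cmod (q b \<alpha>) \<le> (K * real (weight b) ^ s) * real (weight \<alpha>) ^ s"
        by (simp add: weight_add power_mult_distrib mult_ac)
    qed
    have r_growth: "polynomial_growth r"
      unfolding polynomial_growth_def
      by (rule exI[of _ K], rule exI[of _ s]) (simp add: r_def Ks Ks0)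
    have "\<forall>b. \<exists>f. represents (q b) f"
      using polynomial_growth_imp_represents[OF q_growth] by metis
    then obtain fq where fq: "\<And>b. represents (q b) (fq b)"
      by metis
    obtain fr where fr: "represents r fr"
      by (rule polynomial_growth_imp_represents[OF r_growth])
    have c_eq: "c = (\<lambda>\<gamma>. (\<Sum>b\<in>B. cauchy_product (q b) (p b) \<gamma>) + r \<gamma>)"
    proof
      fix \<gamma>
      show "c \<gamma> = (\<Sum>b\<in>B. cauchy_product (q b) (p b) \<gamma>) + r \<gamma>"
        unfolding q_def r_def h_def by (rule division_series_identity[OF B(1) pf(3,4) \<sigma>])
    qed
    define F where "F x = (\<Sum>b\<in>B. fq b x * f b x)" for x
    have "represents c (\<lambda>x. F x + fr x)"
      unfolding c_eq F_def
      by (intro represents_add represents_sum represents_cauchy_product B(1) fq fr pf(1))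
    then have g_eq: "\<forall>\<^sub>F x in nhds 0. g x = F x + fr x"
      by (rule represents_unique[OF c])
    have an: "analytic_at_origin (fq b)" "analytic_at_origin fr" for b
      using fq fr analytic_at_origin_iff_represents by blast+
    have F_mem: "germ F \<in> J"
      if "ideal J \<O>" "\<And>b. b \<in> B \<Longrightarrow> germ (f b) \<in> J" for J
      unfolding F_def
      by (intro ideal_germ_sum ideal_germ_mult that B(1) an f_an analytic_at_origin_mult)
    have F_an: "analytic_at_origin F"
      unfolding F_def by (intro analytic_at_origin_sum analytic_at_origin_mult B(1) an f_an)
    \<comment> \<open>the remainder \<open>fr\<close> is the difference of two elements of \<open>I\<close>\<close>
    have "germ (\<lambda>x. g x + - 1 * F x) \<in> I"
      by (intro ideal_germ_add ideal_germ_mult I g(2) F_mem pf(2) F_an analytic_at_origin_mult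
          analytic_at_origin_const u[unfolded g(1)])
    also have "germ (\<lambda>x. g x + - 1 * F x) = germ fr"
      unfolding germ_eq_iff using g_eq by eventually_elim simp
    finally have fr_I: "germ fr \<in> I" .
    have "r = (\<lambda>\<gamma>. 0)"
    proof (rule ccontr)
      assume "r \<noteq> (\<lambda>\<gamma>. 0)"
      then obtain \<gamma> where "r \<gamma> \<noteq> 0" by auto
      from ex_has_least_nat[of "\<lambda>\<gamma>. r \<gamma> \<noteq> 0", OF this, of weight]
      obtain a where a: "r a \<noteq> 0" "\<forall>\<beta>. r \<beta> \<noteq> 0 \<longrightarrow> weight a \<le> weight \<beta>"
        by blast
      have "represents (\<lambda>\<alpha>. 1 / r a * r \<alpha>) (\<lambda>x. 1 / r a * fr x)"
        by (rule represents_scale[OF fr])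
      moreover have "germ (\<lambda>x. 1 / r a * fr x) \<in> I"
        by (intro ideal_germ_mult I an fr_I analytic_at_origin_const)
      ultimately have "(\<lambda>\<alpha>. 1 / r a * r \<alpha>) \<in> S"
        unfolding S_def by blast
      moreover have "1 / r a * r \<beta> = 0" if "weight \<beta> < weight a" for \<beta>
        using a(2) that by (metis mult_zero_right not_le)
      moreover have "1 / r a * r a = 1"
        using a(1) by simp
      ultimately have "a \<in> E"
        unfolding E_def by (intro CollectI bexI[of _ "\<lambda>\<alpha>. 1 / r a * r \<alpha>"] conjI allI impI)
      then have "\<exists>b\<in>B. \<exists>\<alpha>. a = \<alpha> + b"
        by (rule B(3))
      with a(1) show False
        by (simp add: r_def)
    qed
    then have "\<forall>\<^sub>F x in nhds 0. fr x = 0"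
      using fr represents_unique[OF _ represents_zero] by simp
    with g_eq have "\<forall>\<^sub>F x in nhds 0. g x = F x"
      by eventually_elim simp
    then have "u = germ F"
      by (simp add: g(1) germ_eq_iff)
    also have "germ F \<in> ideal_generated_by gs"
      by (rule F_mem[OF ideal_generated_by_ideal(1)[OF gs(1)] ideal_generated_by_ideal(2)[OF gs(1)]])
        (simp add: gs(2))
    finally show ?thesis .
  qed
  moreover have "ideal_generated_by gs \<subseteq> I"
    by (rule ideal_generated_by_minimal[OF I]) (auto simp: gs(2) pf(2))
  ultimately have "I = ideal_generated_by gs"
    by blast
  with gs(1) show thesis
    by (rule that)
qed

section \<open>Integral closure and size of generators\<close>

text \<open>The value of a germ off the origin is only defined through a representative, hence the existential
quantifier over \<open>f\<close>.\<close>

definition dominated :: "(complex ^ 'n \<Rightarrow> real) \<Rightarrow> (complex ^ 'n \<Rightarrow> complex) set \<Rightarrow> bool" where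
  "dominated b u \<longleftrightarrow> (\<exists>f C. analytic_at_origin f \<and> u = germ f \<and> (\<forall>\<^sub>F x in nhds 0. cmod (f x) \<le> C * b x))"

lemma dominatedI:
  "analytic_at_origin f \<Longrightarrow> \<forall>\<^sub>F x in nhds 0. cmod (f x) \<le> C * b x \<Longrightarrow> dominated b (germ f)"
  unfolding dominated_def by blast

lemma dominatedE:
  assumes "dominated b u"
  obtains f C where "analytic_at_origin f" "u = germ f" "\<forall>\<^sub>F x in nhds 0. cmod (f x) \<le> C * b x"
  using assms unfolding dominated_def by blast

lemma dominated_germE:
  assumes "dominated b (germ f)"
  obtains C where "\<forall>\<^sub>F x in nhds 0. cmod (f x) \<le> C * b x"
proof -
  obtain g C where g: "germ f = germ g" "\<forall>\<^sub>F x in nhds 0. cmod (g x) \<le> C * b x"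
    using assms by (rule dominatedE)
  have "\<forall>\<^sub>F x in nhds 0. cmod (f x) \<le> C * b x"
    using g(1)[unfolded germ_eq_iff] g(2) by eventually_elim simp
  then show thesis
    by (rule that)
qed

lemma dominated_add:
  assumes "dominated b u" "dominated b v"
  shows "dominated b (u \<oplus>\<^bsub>\<O>\<^esub> v)"
proof -
  obtain f C where f: "analytic_at_origin f" "u = germ f" "\<forall>\<^sub>F x in nhds 0. cmod (f x) \<le> C * b x"
    using assms(1) by (rule dominatedE)
  obtain g D where g: "analytic_at_origin g" "v = germ g" "\<forall>\<^sub>F x in nhds 0. cmod (g x) \<le> D * b x"
    using assms(2) by (rule dominatedE)
  have "\<forall>\<^sub>F x in nhds 0. cmod (f x + g x) \<le> (C + D) * b x"
    using f(3) g(3)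
  proof eventually_elim
    case (elim x)
    then show ?case
      using norm_triangle_ineq[of "f x" "g x"] by (simp add: distrib_right)
  qed
  from dominatedI[OF analytic_at_origin_add[OF f(1) g(1)] this] show ?thesis
    by (simp add: f g germ_add)
qed

lemma dominated_mult:
  assumes "dominated b u" "dominated b' v"
  shows "dominated (\<lambda>x. b x * b' x) (u \<otimes>\<^bsub>\<O>\<^esub> v)"
proof -
  obtain f C where f: "analytic_at_origin f" "u = germ f" "\<forall>\<^sub>F x in nhds 0. cmod (f x) \<le> C * b x"
    using assms(1) by (rule dominatedE)
  obtain g D where g: "analytic_at_origin g" "v = germ g" "\<forall>\<^sub>F x in nhds 0. cmod (g x) \<le> D * b' x"
    using assms(2) by (rule dominatedE)
  have "\<forall>\<^sub>F x in nhds 0. cmod (f x * g x) \<le> (C * D) * (b x * b' x)"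
    using f(3) g(3)
  proof eventually_elim
    case (elim x)
    have "cmod (f x * g x) \<le> (C * b x) * (D * b' x)"
      unfolding norm_mult by (rule mult_mono[OF elim order_trans[OF norm_ge_zero elim(1)] norm_ge_zero])
    then show ?case
      by (simp only: mult_ac)
  qed
  from dominatedI[OF analytic_at_origin_mult[OF f(1) g(1)] this] show ?thesis
    by (simp add: f g germ_mult)
qed

lemma dominated_one: "u \<in> carrier \<O> \<Longrightarrow> dominated (\<lambda>x. 1) u"
proof -
  assume "u \<in> carrier \<O>"
  then obtain f where f: "analytic_at_origin f" "u = germ f"
    by (auto simp: carrier_germ_ring)
  obtain C where "0 \<le> C" "\<forall>\<^sub>F x in nhds 0. cmod (f x) \<le> C"
    by (rule analytic_at_origin_bounded[OF f(1)])
  then show ?thesis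
    unfolding f(2) by (intro dominatedI[OF f(1), of C]) simp
qed

lemma dominated_imp_carrier: "dominated b u \<Longrightarrow> u \<in> carrier \<O>"
  by (auto elim!: dominatedE)

text \<open>Analytic germs are bounded near the origin, so multiplying by them preserves domination. As a
consequence, a bound for the generators of an ideal is a bound for all of its elements.\<close>

lemma ideal_dominated:
  fixes b :: "complex ^ 'n \<Rightarrow> real"
  shows "ideal {u. dominated b u} \<O>"
proof -
  interpret cring "\<O> :: (complex ^ 'n \<Rightarrow> complex) set ring"
    by (rule cring_germ_ring)
  have mult: "dominated b (k \<otimes>\<^bsub>\<O>\<^esub> u)" if "dominated b u" "k \<in> carrier \<O>" for k u :: "(complex ^ 'n \<Rightarrow> complex) set"
    using dominated_mult[OF dominated_one[OF that(2)] that(1)] by simp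
  show ?thesis
  proof (rule idealI)
    show "ring (\<O> :: (complex ^ 'n \<Rightarrow> complex) set ring)"
      by (rule ring_axioms)
    show "subgroup {u. dominated b u} (add_monoid (\<O> :: (complex ^ 'n \<Rightarrow> complex) set ring))"
    proof (rule add.subgroupI)
      show "{u. dominated b u} \<subseteq> carrier \<O>"
        using dominated_imp_carrier by blast
      have "dominated b \<zero>\<^bsub>\<O>\<^esub>"
        unfolding germ_zero by (rule dominatedI[OF analytic_at_origin_const, of _ 0]) simp
      then show "{u. dominated b u} \<noteq> {}"
        by blast
    next
      fix u :: "(complex ^ 'n \<Rightarrow> complex) set" assume "u \<in> {u. dominated b u}"
      then have u: "dominated b u" "u \<in> carrier \<O>"
        using dominated_imp_carrier by blast+
      then have "dominated b ((\<ominus>\<^bsub>\<O>\<^esub> \<one>\<^bsub>\<O>\<^esub>) \<otimes>\<^bsub>\<O>\<^esub> u)"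
        by (intro mult) simp_all
      then show "\<ominus>\<^bsub>\<O>\<^esub> u \<in> {u. dominated b u}"
        using u(2) by (simp add: l_minus)
    qed (simp add: dominated_add)
  next
    fix u k :: "(complex ^ 'n \<Rightarrow> complex) set" assume "u \<in> {u. dominated b u}" "k \<in> carrier \<O>"
    then show "k \<otimes>\<^bsub>\<O>\<^esub> u \<in> {u. dominated b u}"
      using mult by simp
    then show "u \<otimes>\<^bsub>\<O>\<^esub> k \<in> {u. dominated b u}"
      using m_comm[of u k] dominated_imp_carrier[of b u] \<open>u \<in> _\<close> \<open>k \<in> carrier \<O>\<close> by simp
  qed
qed

lemma tuple_norm_simps:
  "tuple_norm [] x = 0"
  "(tuple_norm (f # fs) x)\<^sup>2 = (cmod (f x))\<^sup>2 + (tuple_norm fs x)\<^sup>2"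
  "0 \<le> tuple_norm fs x"
  "(tuple_norm fs x)\<^sup>2 = (\<Sum>f\<leftarrow>fs. (cmod (f x))\<^sup>2)"
proof -
  have nn: "0 \<le> (\<Sum>f\<leftarrow>fs. (cmod (f x))\<^sup>2)" for fs
    by (intro sum_list_nonneg) auto
  show "tuple_norm [] x = 0" "(tuple_norm (f # fs) x)\<^sup>2 = (cmod (f x))\<^sup>2 + (tuple_norm fs x)\<^sup>2"
    "0 \<le> tuple_norm fs x" "(tuple_norm fs x)\<^sup>2 = (\<Sum>f\<leftarrow>fs. (cmod (f x))\<^sup>2)"
    using nn[of fs] by (simp_all add: tuple_norm_def)
qed

lemma norm_le_tuple_norm: "f \<in> set fs \<Longrightarrow> cmod (f x) \<le> tuple_norm fs x"
proof (induction fs)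
  case (Cons g fs)
  have "(cmod (f x))\<^sup>2 \<le> (tuple_norm (g # fs) x)\<^sup>2"
  proof (cases "f = g")
    case True
    then show ?thesis
      by (simp add: tuple_norm_simps(2))
  next
    case False
    with Cons have "(cmod (f x))\<^sup>2 \<le> (tuple_norm fs x)\<^sup>2"
      by (intro power_mono) auto
    then show ?thesis
      by (simp add: tuple_norm_simps(2) add_increasing)
  qed
  then show ?case
    using tuple_norm_simps(3) by (rule power2_le_imp_le)
qed simp

lemma tuple_norm_Cons_le: "tuple_norm (g # gs) x \<le> cmod (g x) + tuple_norm gs x"
proof (rule power2_le_imp_le)
  show "(tuple_norm (g # gs) x)\<^sup>2 \<le> (cmod (g x) + tuple_norm gs x)\<^sup>2"
    using tuple_norm_simps(3)[of gs x] by (simp add: tuple_norm_simps(2) power2_sum)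
qed (simp add: tuple_norm_simps(3))

lemma tuple_norm_le_if_dominated:
  assumes "\<And>g. g \<in> set gs \<Longrightarrow> dominated b (germ g)"
  obtains C where "\<forall>\<^sub>F x in nhds 0. tuple_norm gs x \<le> C * b x"
proof -
  have "\<exists>C. \<forall>\<^sub>F x in nhds 0. tuple_norm gs x \<le> C * b x"
    using assms
  proof (induction gs)
    case Nil
    show ?case
      by (rule exI[of _ 0]) (simp add: tuple_norm_simps(1))
  next
    case (Cons g gs)
    then obtain C where C: "\<forall>\<^sub>F x in nhds 0. tuple_norm gs x \<le> C * b x"
      by auto
    obtain D where D: "\<forall>\<^sub>F x in nhds 0. cmod (g x) \<le> D * b x"
      using dominated_germE Cons.prems list.set_intros(1) by metis
    have "\<forall>\<^sub>F x in nhds 0. tuple_norm (g # gs) x \<le> (D + C) * b x"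
      using C D
    proof eventually_elim
      case (elim x)
      then show ?case
        using tuple_norm_Cons_le[of g gs x] by (simp add: distrib_right)
    qed
    then show ?case ..
  qed
  then show thesis
    using that by blast
qed

lemma ideal_generated_by_dominated:
  assumes "\<forall>f\<in>set fs. analytic_at_origin f" "u \<in> ideal_generated_by fs"
  shows "dominated (tuple_norm fs) u"
proof -
  have "ideal_generated_by fs \<subseteq> {u. dominated (tuple_norm fs) u}"
  proof (rule ideal_generated_by_minimal[OF ideal_dominated])
    fix f assume "f \<in> set fs"
    then have "dominated (tuple_norm fs) (germ f)"
      using assms(1) by (intro dominatedI[of f 1]) (simp_all add: norm_le_tuple_norm)
    then show "germ f \<in> {u. dominated (tuple_norm fs) u}"
      by simp
  qed
  with assms(2) show ?thesis
    by blast
qed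

lemma ideal_power_dominated:
  assumes "\<And>u. u \<in> I \<Longrightarrow> dominated b u" "u \<in> ideal_power \<O> I i"
  shows "dominated (\<lambda>x. b x ^ i) u"
  using assms(2)
proof (induction i arbitrary: u)
  case 0
  then show ?case
    by (simp add: dominated_one)
next
  case (Suc i)
  then have "u \<in> ideal_prod \<O> I (ideal_power \<O> I i)"
    by simp
  then show ?case
  proof (induction rule: ideal_prod.induct)
    case (prod v w)
    then show ?case
      using dominated_mult[OF assms(1) Suc.IH] by simp
  next
    case (sum v w)
    then show ?case
      by (intro dominated_add)
  qed
qed

text \<open>If \<open>|z| \<ge> b\<close>, each summand \<open>c i * z ^ (k - i)\<close> is at most \<open>C b |z| ^ (k - 1)\<close>, and comparing with
\<open>|z| ^ k\<close> gives \<open>|z| \<le> k C b\<close>. The extra \<open>1\<close> makes the negated conclusion imply \<open>|z| \<ge> b\<close>.\<close>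

lemma root_bound:
  fixes z :: complex
  assumes k: "1 \<le> k" and "0 \<le> b" "0 \<le> C"
    and c: "\<And>i. i \<in> {1..k} \<Longrightarrow> cmod (c i) \<le> C * b ^ i"
    and eq: "z ^ k + (\<Sum>i\<in>{1..k}. c i * z ^ (k - i)) = 0"
  shows "cmod z \<le> (1 + real k * C) * b"
proof (rule ccontr)
  assume "\<not> cmod z \<le> (1 + real k * C) * b"
  moreover have "0 \<le> real k * C * b"
    using assms(2,3) by simp
  ultimately have z: "real k * C * b < cmod z" "b \<le> cmod z" "0 < cmod z"
    using \<open>0 \<le> b\<close> unfolding distrib_right by linarith+
  have summand: "cmod (c i * z ^ (k - i)) \<le> C * b * cmod z ^ (k - 1)" if i: "i \<in> {1..k}" for i
  proof -
    obtain j where j: "i = Suc j"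
      using i by (cases i) auto
    have "cmod (c i * z ^ (k - i)) \<le> C * b ^ i * cmod z ^ (k - i)"
      unfolding norm_mult norm_power by (rule mult_right_mono[OF c[OF i]]) simp
    also have "\<dots> = C * b * (b ^ j * cmod z ^ (k - i))"
      by (simp add: j mult.assoc)
    also have "\<dots> \<le> C * b * (cmod z ^ j * cmod z ^ (k - i))"
      using z(2) assms(2,3) by (intro mult_left_mono mult_right_mono power_mono) auto
    also have "cmod z ^ j * cmod z ^ (k - i) = cmod z ^ (k - 1)"
      using i by (simp add: j flip: power_add)
    finally show ?thesis .
  qed
  have "z ^ k = - (\<Sum>i\<in>{1..k}. c i * z ^ (k - i))"
    using eq by (simp add: eq_neg_iff_add_eq_0)
  then have "cmod z ^ k = cmod (\<Sum>i\<in>{1..k}. c i * z ^ (k - i))"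
    by (metis norm_minus_cancel norm_power)
  also have "\<dots> \<le> (\<Sum>i\<in>{1..k}. C * b * cmod z ^ (k - 1))"
    by (rule sum_norm_le[OF summand])
  also have "\<dots> = real k * C * b * cmod z ^ (k - 1)"
    by simp
  also have "\<dots> < cmod z * cmod z ^ (k - 1)"
    using z by (intro mult_strict_right_mono) auto
  also have "\<dots> = cmod z ^ k"
    using k by (simp flip: power_Suc)
  finally show False
    by simp
qed

lemma analytic_at_origin_power:
  "analytic_at_origin f \<Longrightarrow> analytic_at_origin (\<lambda>x. f x ^ n)"
  by (induction n) (simp_all add: analytic_at_origin_const analytic_at_origin_mult)

lemma germ_power:
  fixes f :: "complex ^ 'n \<Rightarrow> complex"
  assumes f: "analytic_at_origin f"
  shows "germ f [^]\<^bsub>\<O>\<^esub> n = germ (\<lambda>x. f x ^ n)"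
proof -
  interpret cring "\<O> :: (complex ^ 'n \<Rightarrow> complex) set ring"
    by (rule cring_germ_ring)
  show ?thesis
  proof (induction n)
    case 0
    show ?case
      by (simp add: germ_one)
  next
    case (Suc n)
    then show ?case
      using germ_mult[OF analytic_at_origin_power[OF f] f] by (simp add: mult.commute)
  qed
qed

lemma germ_sum:
  fixes F :: "'i \<Rightarrow> complex ^ 'n \<Rightarrow> complex"
  assumes "finite A" "\<And>i. i \<in> A \<Longrightarrow> analytic_at_origin (F i)"
  shows "(\<Oplus>\<^bsub>\<O>\<^esub>i\<in>A. germ (F i)) = germ (\<lambda>x. \<Sum>i\<in>A. F i x)"
proof -
  interpret cring "\<O> :: (complex ^ 'n \<Rightarrow> complex) set ring"
    by (rule cring_germ_ring)
  show ?thesis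
    using assms
  proof (induction A rule: finite_induct)
    case empty
    show ?case
      by (simp add: germ_zero)
  next
    case (insert a A)
    then have "(\<lambda>i. germ (F i)) \<in> A \<rightarrow> carrier \<O>" "germ (F a) \<in> carrier \<O>"
      by auto
    with insert show ?case
      by (simp add: germ_add analytic_at_origin_sum)
  qed
qed

text \<open>The coefficient \<open>a i\<close> of an integral equation lies in the \<open>i\<close>-th power of the ideal and is thus
dominated by the \<open>i\<close>-th power of the norm of the generators, so the root bound applies pointwise.\<close>

lemma integral_closure_dominated:
  fixes h :: "(complex ^ 'n \<Rightarrow> complex) set"
  assumes fs: "\<forall>f\<in>set fs. analytic_at_origin f"
    and h: "h \<in> integral_closure \<O> (ideal_generated_by fs)"
  shows "dominated (tuple_norm fs) h"
proof -
  interpret cring "\<O> :: (complex ^ 'n \<Rightarrow> complex) set ring"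
    by (rule cring_germ_ring)
  obtain k a where k: "1 \<le> k" and a: "\<forall>i\<in>{1..k}. a i \<in> ideal_power \<O> (ideal_generated_by fs) i"
    and eq: "h [^]\<^bsub>\<O>\<^esub> k \<oplus>\<^bsub>\<O>\<^esub> (\<Oplus>\<^bsub>\<O>\<^esub>i\<in>{1..k}. a i \<otimes>\<^bsub>\<O>\<^esub> h [^]\<^bsub>\<O>\<^esub> (k - i)) = \<zero>\<^bsub>\<O>\<^esub>"
    and hc: "h \<in> carrier \<O>"
    using h unfolding integral_closure_def by blast
  obtain H where H: "analytic_at_origin H" "h = germ H"
    using hc by (auto simp: carrier_germ_ring)
  have "\<forall>i\<in>{1..k}. \<exists>A C. analytic_at_origin A \<and> a i = germ A \<and>
      (\<forall>\<^sub>F x in nhds 0. cmod (A x) \<le> C * tuple_norm fs x ^ i)"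
  proof
    fix i assume "i \<in> {1..k}"
    from ideal_power_dominated[OF ideal_generated_by_dominated[OF fs] bspec[OF a this]]
    show "\<exists>A C. analytic_at_origin A \<and> a i = germ A \<and>
        (\<forall>\<^sub>F x in nhds 0. cmod (A x) \<le> C * tuple_norm fs x ^ i)"
      unfolding dominated_def .
  qed
  then obtain A C where AC: "\<forall>i\<in>{1..k}. analytic_at_origin (A i) \<and> a i = germ (A i) \<and>
      (\<forall>\<^sub>F x in nhds 0. cmod (A i x) \<le> C i * tuple_norm fs x ^ i)"
    unfolding bchoice_iff by blast
  have A: "analytic_at_origin (A i)" "a i = germ (A i)"
      "\<forall>\<^sub>F x in nhds 0. cmod (A i x) \<le> C i * tuple_norm fs x ^ i" if "i \<in> {1..k}" for i
    using bspec[OF AC that] by simp_all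
  have term_an: "analytic_at_origin (\<lambda>x. A i x * H x ^ (k - i))" if "i \<in> {1..k}" for i
    by (rule analytic_at_origin_mult[OF A(1)[OF that] analytic_at_origin_power[OF H(1)]])
  have "(\<Oplus>\<^bsub>\<O>\<^esub>i\<in>{1..k}. a i \<otimes>\<^bsub>\<O>\<^esub> h [^]\<^bsub>\<O>\<^esub> (k - i))
      = (\<Oplus>\<^bsub>\<O>\<^esub>i\<in>{1..k}. germ (\<lambda>x. A i x * H x ^ (k - i)))"
    using term_an
    by (intro finsum_cong') (simp_all add: A H germ_power germ_mult analytic_at_origin_power)
  also have "\<dots> = germ (\<lambda>x. \<Sum>i\<in>{1..k}. A i x * H x ^ (k - i))"
    by (rule germ_sum[OF _ term_an]) simp
  finally have sum_eq: "(\<Oplus>\<^bsub>\<O>\<^esub>i\<in>{1..k}. a i \<otimes>\<^bsub>\<O>\<^esub> h [^]\<^bsub>\<O>\<^esub> (k - i))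
      = germ (\<lambda>x. \<Sum>i\<in>{1..k}. A i x * H x ^ (k - i))" .
  have sum_an: "analytic_at_origin (\<lambda>x. \<Sum>i\<in>{1..k}. A i x * H x ^ (k - i))"
    by (rule analytic_at_origin_sum[OF _ term_an]) simp
  have "germ (\<lambda>x. H x ^ k + (\<Sum>i\<in>{1..k}. A i x * H x ^ (k - i)))
      = germ (\<lambda>x. H x ^ k) \<oplus>\<^bsub>\<O>\<^esub> germ (\<lambda>x. \<Sum>i\<in>{1..k}. A i x * H x ^ (k - i))"
    by (rule germ_add[OF analytic_at_origin_power[OF H(1)] sum_an, symmetric])
  also have "germ (\<lambda>x. H x ^ k) = h [^]\<^bsub>\<O>\<^esub> k"
    unfolding H(2) by (rule germ_power[OF H(1), symmetric])
  also have "h [^]\<^bsub>\<O>\<^esub> k \<oplus>\<^bsub>\<O>\<^esub> germ (\<lambda>x. \<Sum>i\<in>{1..k}. A i x * H x ^ (k - i)) = germ (\<lambda>x. 0)"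
    using eq unfolding sum_eq germ_zero .
  finally have "germ (\<lambda>x. H x ^ k + (\<Sum>i\<in>{1..k}. A i x * H x ^ (k - i))) = germ (\<lambda>x. 0)" .
  then have H_eq: "\<forall>\<^sub>F x in nhds 0. H x ^ k + (\<Sum>i\<in>{1..k}. A i x * H x ^ (k - i)) = 0"
    by (simp only: germ_eq_iff)
  define D where "D = (\<Sum>i\<in>{1..k}. \<bar>C i\<bar>)"
  have D: "0 \<le> D" "C i \<le> D" if "i \<in> {1..k}" for i
  proof -
    have "\<bar>C i\<bar> \<le> D"
      unfolding D_def using that by (intro member_le_sum) auto
    then show "0 \<le> D" "C i \<le> D"
      by linarith+
  qed
  have "\<forall>\<^sub>F x in nhds 0. \<forall>i\<in>{1..k}. cmod (A i x) \<le> C i * tuple_norm fs x ^ i"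
    by (rule eventually_ball_finite) (simp_all add: A(3) del: atLeastAtMost_iff)
  with H_eq have "\<forall>\<^sub>F x in nhds 0. cmod (H x) \<le> (1 + real k * D) * tuple_norm fs x"
  proof eventually_elim
    case (elim x)
    show ?case
    proof (rule root_bound[OF k tuple_norm_simps(3) _ _ elim(1)])
      show "0 \<le> D"
        using D(1)[of 1] k by simp
      fix i assume i: "i \<in> {1..k}"
      then have "cmod (A i x) \<le> C i * tuple_norm fs x ^ i"
        using elim(2) by blast
      also have "\<dots> \<le> D * tuple_norm fs x ^ i"
        by (intro mult_right_mono D(2)[OF i] zero_le_power tuple_norm_simps(3))
      finally show "cmod (A i x) \<le> D * tuple_norm fs x ^ i" .
    qed
  qed
  then show ?thesis
    unfolding H(2) by (rule dominatedI[OF H(1)])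
qed

text \<open>An element \<open>h\<close> satisfies the integral equation \<open>h - h = 0\<close> of degree one.\<close>

lemma ideal_subset_integral_closure:
  fixes I :: "(complex ^ 'n \<Rightarrow> complex) set set"
  assumes I: "ideal I \<O>"
  shows "I \<subseteq> integral_closure \<O> I"
proof
  interpret cring "\<O> :: (complex ^ 'n \<Rightarrow> complex) set ring"
    by (rule cring_germ_ring)
  fix h assume h: "h \<in> I"
  have hc: "h \<in> carrier \<O>"
    by (rule ideal.Icarr[OF I h])
  define a where "a = (\<lambda>i :: nat. \<ominus>\<^bsub>\<O>\<^esub> h)"
  have "\<ominus>\<^bsub>\<O>\<^esub> h \<in> I"
    by (rule additive_subgroup.a_inv_closed[OF ideal.axioms(1)[OF I] h])
  from ideal_prod.prod[OF this one_closed, of "\<O>"]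
  have "\<forall>i\<in>{1..1}. a i \<in> ideal_power \<O> I i"
    using hc by (simp add: a_def)
  moreover have "h [^]\<^bsub>\<O>\<^esub> (1 :: nat) \<oplus>\<^bsub>\<O>\<^esub> (\<Oplus>\<^bsub>\<O>\<^esub>i\<in>{1..1}. a i \<otimes>\<^bsub>\<O>\<^esub> h [^]\<^bsub>\<O>\<^esub> (1 - i)) = \<zero>\<^bsub>\<O>\<^esub>"
    using hc by (simp add: a_def r_neg)
  ultimately show "h \<in> integral_closure \<O> I"
    unfolding integral_closure_def using hc
    by (intro CollectI conjI exI[of _ "1 :: nat"] exI[of _ a] order_refl)
qed

text \<open>The generators of \<open>I\<close> are integral over \<open>\<langle>fs\<rangle>\<close>, which bounds them by the norm of \<open>fs\<close>; the other
bound holds because \<open>fs\<close> lies in \<open>I\<close>.\<close>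

lemma generators_equivalent:
  fixes I :: "(complex ^ 'n \<Rightarrow> complex) set set"
  assumes I: "ideal I \<O>" and gs: "\<forall>g\<in>set gs. analytic_at_origin g" "I = ideal_generated_by gs"
    and fs: "\<forall>f\<in>set fs. analytic_at_origin f" "ideal_generated_by fs \<subseteq> I"
    and closure: "integral_closure \<O> (ideal_generated_by fs) = integral_closure \<O> I"
  obtains C D where "\<forall>\<^sub>F x in nhds 0. tuple_norm fs x \<le> C * tuple_norm gs x"
    "\<forall>\<^sub>F x in nhds 0. tuple_norm gs x \<le> D * tuple_norm fs x"
proof -
  have "dominated (tuple_norm gs) (germ f)" if "f \<in> set fs" for f
    using ideal_generated_by_dominated[OF gs(1)] ideal_generated_by_ideal(2)[OF fs(1) that] fs(2) gs(2)
    by blast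
  then obtain C where C: "\<forall>\<^sub>F x in nhds 0. tuple_norm fs x \<le> C * tuple_norm gs x"
    by (rule tuple_norm_le_if_dominated)
  have "dominated (tuple_norm fs) (germ g)" if "g \<in> set gs" for g
    using integral_closure_dominated[OF fs(1)] ideal_generated_by_ideal(2)[OF gs(1) that]
      ideal_subset_integral_closure[OF I] closure gs(2)
    by blast
  then obtain D where D: "\<forall>\<^sub>F x in nhds 0. tuple_norm gs x \<le> D * tuple_norm fs x"
    by (rule tuple_norm_le_if_dominated)
  show thesis
    by (rule that[OF C D])
qed

section \<open>Lipschitz maps and Lebesgue measure\<close>

text \<open>By Vitali there are disjoint balls inside \<open>W\<close>, centred in \<open>A\<close>, whose fivefold enlargements cover \<open>A\<close>.
The image of \<open>A\<close> is covered by balls around the images of the centres with radii \<open>5 C\<close> times the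
original ones.\<close>

lemma emeasure_lipschitz_image_le_open:
  fixes \<phi> :: "'a::euclidean_space \<Rightarrow> 'a"
  assumes lip: "C-lipschitz_on A \<phi>" and W: "open W" "A \<subseteq> W"
    and meas: "\<phi> ` A \<in> sets borel"
  shows "emeasure lborel (\<phi> ` A) \<le> ennreal ((5 * C) ^ DIM('a)) * emeasure lborel W"
proof -
  have C: "0 \<le> C"
    by (rule lipschitz_on_nonneg[OF lip])
  \<comment> \<open>the covering lemma requires bounded radii\<close>
  have "\<exists>r. 0 < r \<and> r \<le> 1 \<and> cball a r \<subseteq> W" if "a \<in> A" for a
  proof -
    obtain e where "0 < e" "cball a e \<subseteq> W"
      using W \<open>a \<in> A\<close> open_contains_cball by blast
    then show ?thesis
      by (intro exI[of _ "min e 1"]) auto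
  qed
  then obtain r where r: "\<And>a. a \<in> A \<Longrightarrow> 0 < r a \<and> r a \<le> 1" "\<And>a. a \<in> A \<Longrightarrow> cball a (r a) \<subseteq> W"
    by metis
  have "A \<subseteq> (\<Union>a\<in>A. cball a (r a))"
    using r(1) by (force simp: less_imp_le)
  then obtain I where I: "countable I" "I \<subseteq> A"
      "pairwise (\<lambda>a b. disjnt (cball a (r a)) (cball b (r b))) I"
      "A \<subseteq> (\<Union>a\<in>I. cball a (5 * r a))"
    by (rule Vitali_covering_lemma_cballs[where a = "\<lambda>a. a", OF _ r(1)])
  \<comment> \<open>the balls and their images, listed as sequences that are empty at the indices not in use\<close>
  define J where "J = to_nat_on I ` I"
  define G where "G n = (if n \<in> J then cball (from_nat_into I n) (r (from_nat_into I n)) else {})" for n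
  define F where "F n = (if n \<in> J then cball (\<phi> (from_nat_into I n)) (5 * C * r (from_nat_into I n)) else {})" for n
  have J: "from_nat_into I n \<in> I" if "n \<in> J" for n
    using that I(1) by (auto simp: J_def)
  have FG: "emeasure lborel (F n) = ennreal ((5 * C) ^ DIM('a)) * emeasure lborel (G n)" for n
  proof (cases "n \<in> J")
    case True
    then have "0 < r (from_nat_into I n)"
      using r(1) J I(2) by blast
    then show ?thesis
      using C True
      by (simp add: F_def G_def emeasure_cball power_mult_distrib mult.left_commute flip: ennreal_mult)
  qed (simp add: F_def G_def)
  have cover: "\<phi> ` A \<subseteq> (\<Union>n. F n)"
  proof
    fix y assume "y \<in> \<phi> ` A"
    then obtain x where x: "x \<in> A" "y = \<phi> x" by blast
    then obtain a where a: "a \<in> I" "dist a x \<le> 5 * r a"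
      using I(4) by auto
    have "dist (\<phi> a) (\<phi> x) \<le> C * dist a x"
      using lipschitz_onD[OF lip] a(1) I(2) x(1) by blast
    also have "\<dots> \<le> C * (5 * r a)"
      using a(2) C by (rule mult_left_mono)
    finally have "dist (\<phi> a) y \<le> 5 * C * r a"
      by (simp add: x(2))
    then have "y \<in> F (to_nat_on I a)"
      using a(1) I(1) by (simp add: F_def J_def)
    then show "y \<in> (\<Union>n. F n)" by blast
  qed
  have disj: "disjoint_family G"
    unfolding disjoint_family_on_def
  proof (intro ballI impI)
    fix m n :: nat assume "m \<noteq> n"
    show "G m \<inter> G n = {}"
    proof (cases "m \<in> J \<and> n \<in> J")
      case True
      then have "from_nat_into I m \<noteq> from_nat_into I n"
        using \<open>m \<noteq> n\<close> I(1) by (auto simp: J_def)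
      then show ?thesis
        using I(3) J True by (auto simp: G_def pairwise_def disjnt_def)
    qed (auto simp: G_def)
  qed
  have sub: "(\<Union>n. G n) \<subseteq> W"
  proof (rule UN_least)
    fix n
    show "G n \<subseteq> W"
      using r(2) J I(2) unfolding G_def by (cases "n \<in> J") auto
  qed
  have [measurable]: "F n \<in> sets borel" "G n \<in> sets borel" for n
    by (simp_all add: F_def G_def)
  then have "emeasure lborel (\<phi> ` A) \<le> emeasure lborel (\<Union>n. F n)"
    by (intro emeasure_mono cover) auto
  also have "\<dots> \<le> (\<Sum>n. emeasure lborel (F n))"
    by (rule emeasure_subadditive_countably) auto
  also have "\<dots> = ennreal ((5 * C) ^ DIM('a)) * (\<Sum>n. emeasure lborel (G n))"
    unfolding FG by (rule ennreal_suminf_cmult)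
  also have "(\<Sum>n. emeasure lborel (G n)) = emeasure lborel (\<Union>n. G n)"
    by (intro suminf_emeasure disj) auto
  also have "\<dots> \<le> emeasure lborel W"
    using W(1) by (intro emeasure_mono sub) auto
  finally show ?thesis
    by (simp add: mult_left_mono)
qed

text \<open>Outer regularity replaces the open set \<open>W\<close> of the previous lemma by \<open>A\<close> itself.\<close>

lemma emeasure_lipschitz_image_le:
  fixes \<phi> :: "'a::euclidean_space \<Rightarrow> 'a"
  assumes lip: "C-lipschitz_on A \<phi>" and A: "A \<in> sets borel" "\<phi> ` A \<in> sets borel"
  shows "emeasure lborel (\<phi> ` A) \<le> ennreal ((5 * C) ^ DIM('a)) * emeasure lborel A"
proof -
  let ?K = "ennreal ((5 * C) ^ DIM('a))"
  have "emeasure lborel (\<phi> ` A) \<le> ?K * emeasure lborel A + ennreal e" if "0 < e" for e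
  proof -
    have C: "0 \<le> C"
      by (rule lipschitz_on_nonneg[OF lip])
    define k where "k = (5 * C) ^ DIM('a)"
    have k: "0 \<le> k"
      using C by (simp add: k_def)
    define d where "d = e / (k + 1)"
    have d: "0 < d"
      using k \<open>0 < e\<close> by (simp add: d_def)
    have "k * d = e * (k / (k + 1))"
      by (simp add: d_def)
    also have "\<dots> \<le> e * 1"
      using k \<open>0 < e\<close> by (intro mult_left_mono) auto
    finally have kd: "k * d \<le> e" by simp
    obtain W where W: "open W" "A \<subseteq> W" "emeasure lborel (W - A) < d"
      using outer_regular_lborel[OF A(1) d] by blast
    have "emeasure lborel W = emeasure lborel (A \<union> (W - A))"
      using W(2) by (simp add: Un_absorb1)
    also have "\<dots> \<le> emeasure lborel A + emeasure lborel (W - A)"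
      using A(1) W(1) by (intro emeasure_subadditive) auto
    also have "\<dots> \<le> emeasure lborel A + ennreal d"
      using W(3) by (intro add_left_mono) simp
    finally have "?K * emeasure lborel W \<le> ?K * (emeasure lborel A + ennreal d)"
      by (intro mult_left_mono) auto
    also have "\<dots> = ?K * emeasure lborel A + ennreal (k * d)"
      using k d by (simp add: distrib_left ennreal_mult k_def)
    also have "\<dots> \<le> ?K * emeasure lborel A + ennreal e"
      using kd by (intro add_left_mono ennreal_leI)
    finally show ?thesis
      using emeasure_lipschitz_image_le_open[OF lip W(1,2) A(2)] by (rule order_trans[rotated])
  qed
  then show ?thesis
    by (rule ennreal_le_epsilon)
qed

section \<open>Integrability under a bi-Lipschitz change of variables\<close>

text \<open>Zeros are harmless: where \<open>a = 0 < s\<close> the right-hand side is infinite, and \<open>b = 0\<close> forces \<open>a = 0\<close>.\<close>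

lemma neg_powr_antimono:
  assumes "0 \<le> a" "0 \<le> b" "0 < c" "0 \<le> s" "a \<le> c * b"
  shows "neg_powr b s \<le> ennreal (c powr s) * neg_powr a s"
proof (cases "a = 0")
  case True
  then show ?thesis
    using \<open>0 < c\<close> by (cases "s = 0") (auto simp: neg_powr_def ennreal_mult_top)
next
  case False
  then have "0 < a"
    using assms(1) by simp
  moreover have "a / c \<le> b"
    using assms(3,5) by (simp add: pos_divide_le_eq mult.commute)
  moreover have "0 < a / c"
    using \<open>0 < a\<close> assms(3) by simp
  ultimately have pos: "0 < a" "0 < b" "a / c \<le> b" "0 < a / c"
    by linarith+
  have "b powr - s \<le> (a / c) powr - s"
    using pos(3,4) \<open>0 \<le> s\<close> by (intro powr_mono2') auto
  also have "\<dots> = c powr s * a powr - s"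
    using pos \<open>0 < c\<close> by (simp add: powr_divide powr_minus_divide)
  finally have "ennreal (b powr - s) \<le> ennreal (c powr s * a powr - s)"
    by (rule ennreal_leI)
  then show ?thesis
    using pos by (simp add: neg_powr_def ennreal_mult)
qed

text \<open>The map \<open>\<psi>\<close> pushes Lebesgue measure on \<open>B\<close> forward to a measure below a multiple of Lebesgue
measure: the preimage under \<open>\<psi>\<close> of a set is contained in its image under the Lipschitz map \<open>\<phi>\<close>.\<close>

lemma nn_integral_lipschitz_pullback_le:
  fixes \<phi> \<psi> :: "'a::euclidean_space \<Rightarrow> 'a"
  assumes lip: "L-lipschitz_on U \<phi>" and B: "compact B" and \<psi>: "continuous_on B \<psi>" "\<psi> ` B \<subseteq> U"
    and inv: "\<And>y. y \<in> B \<Longrightarrow> \<phi> (\<psi> y) = y" and H: "H \<in> borel_measurable borel"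
  shows "(\<integral>\<^sup>+y\<in>B. H (\<psi> y) \<partial>lborel) \<le> ennreal ((5 * L) ^ DIM('a)) * (\<integral>\<^sup>+x. H x \<partial>lborel)"
proof -
  let ?k = "ennreal ((5 * L) ^ DIM('a))"
  let ?M = "restrict_space lborel B"
  have B': "B \<in> sets borel"
    using B by (simp add: compact_imp_closed)
  have \<psi>_meas: "\<psi> \<in> measurable ?M borel"
    unfolding measurable_cong_sets[OF sets_restrict_space_cong[OF sets_lborel] refl]
    by (rule borel_measurable_continuous_on_restrict[OF \<psi>(1)])
  have "distr ?M borel \<psi> \<le> scale_measure ?k lborel"
  proof (subst le_measure, simp, intro ballI)
    fix A assume "A \<in> sets (distr ?M borel \<psi>)"
    then have A: "A \<in> sets borel" by simp
    define D where "D = \<psi> -` A \<inter> B"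
    have "D \<in> sets ?M"
      using measurable_sets[OF \<psi>_meas A] by (simp add: D_def space_restrict_space)
    then have D: "D \<in> sets borel"
      using B' by (auto simp: sets_restrict_space)
    have "\<psi> ` D = A \<inter> \<psi> ` B"
      by (auto simp: D_def)
    moreover have "\<psi> ` B \<in> sets borel"
      using compact_continuous_image[OF \<psi>(1) B] by (simp add: compact_imp_closed)
    ultimately have \<psi>D: "\<psi> ` D \<in> sets borel"
      using A by simp
    have "\<phi> ` \<psi> ` D = (\<lambda>y. y) ` D"
      unfolding image_image by (rule image_cong) (simp_all add: D_def inv)
    then have \<phi>\<psi>D: "\<phi> ` \<psi> ` D = D"
      by simp
    have "L-lipschitz_on (\<psi> ` D) \<phi>"
      by (rule lipschitz_on_subset[OF lip]) (use \<psi>(2) in \<open>auto simp: D_def\<close>)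
    from emeasure_lipschitz_image_le[OF this \<psi>D] have "emeasure lborel D \<le> ?k * emeasure lborel (\<psi> ` D)"
      using D \<phi>\<psi>D by simp
    also have "emeasure lborel (\<psi> ` D) \<le> emeasure lborel A"
      using A by (intro emeasure_mono) (auto simp: D_def)
    finally have "emeasure lborel D \<le> ?k * emeasure lborel A"
      by (simp add: mult_left_mono)
    then show "emeasure (distr ?M borel \<psi>) A \<le> emeasure (scale_measure ?k lborel) A"
      using B' emeasure_distr[OF \<psi>_meas A] emeasure_restrict_space[of B lborel D]
      by (simp add: space_restrict_space D_def)
  qed
  then have "(\<integral>\<^sup>+x. H x \<partial>distr ?M borel \<psi>) \<le> (\<integral>\<^sup>+x. H x \<partial>scale_measure ?k lborel)"
    by (rule nn_integral_mono_measure[rotated]) simp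
  also have "(\<integral>\<^sup>+x. H x \<partial>distr ?M borel \<psi>) = (\<integral>\<^sup>+y\<in>B. H (\<psi> y) \<partial>lborel)"
    using B' H by (simp add: nn_integral_distr[OF \<psi>_meas] nn_integral_restrict_space)
  also have "(\<integral>\<^sup>+x. H x \<partial>scale_measure ?k lborel) = ?k * (\<integral>\<^sup>+x. H x \<partial>lborel)"
    using H by (simp add: nn_integral_scale_measure)
  finally show ?thesis .
qed

lemma borel_measurable_neg_powr [measurable]: "(\<lambda>t. neg_powr t s) \<in> borel_measurable borel"
proof (cases "s = 0")
  case False
  have "(\<lambda>t::real. if t = 0 then \<infinity> else ennreal (t powr (- s))) \<in> borel_measurable borel"
    by measurable
  then show ?thesis
    using False by (simp add: neg_powr_def cong: if_cong)
qed (simp add: neg_powr_def)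

text \<open>On a small closed ball the integrand \<open>v ^ (- s)\<close> is at most a multiple of \<open>u ^ (- s) \<circ> \<psi>\<close>, where \<open>\<psi>\<close> is
the inverse of \<open>\<phi>\<close>, and the integral of the latter is bounded by a change of variables. Continuity of \<open>v\<close>
supplies measurability.\<close>

lemma integrable_near_origin_transfer:
  fixes \<phi> :: "'a::euclidean_space \<Rightarrow> 'a"
  assumes \<phi>: "bilipschitz_homeo_germ \<phi>" and "0 \<le> s"
    and V: "open V" "0 \<in> V" "continuous_on V v"
    and nonneg: "\<And>x. 0 \<le> u x" "\<And>x. 0 \<le> v x"
    and le: "\<forall>\<^sub>F x in nhds 0. u x \<le> c * v (\<phi> x)"
    and int: "integrable_near_origin (\<lambda>x. neg_powr (u x) s)"
  shows "integrable_near_origin (\<lambda>x. neg_powr (v x) s)"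
proof -
  obtain U W \<psi> L where UW: "open U" "open W" "0 \<in> U" "0 \<in> W" "\<phi> 0 = 0"
      and hom: "homeomorphism U W \<phi> \<psi>" and lip: "L-lipschitz_on U \<phi>"
    using \<phi> unfolding bilipschitz_homeo_germ_def bilipschitz_homeo_def by blast
  obtain K where K: "compact K" "0 \<in> interior K"
      "(\<lambda>x. neg_powr (u x) s * indicator K x) \<in> borel_measurable lborel"
      "(\<integral>\<^sup>+x\<in>K. neg_powr (u x) s \<partial>lborel) < \<infinity>"
    using int unfolding integrable_near_origin_def by blast
  obtain N where "open N \<and> 0 \<in> N \<and> (\<forall>x\<in>N. u x \<le> c * v (\<phi> x))"
    using le[unfolded eventually_nhds] ..
  then have N: "open N" "0 \<in> N" "\<And>x. x \<in> N \<Longrightarrow> u x \<le> c * v (\<phi> x)"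
    by auto
  \<comment> \<open>the constant enters as \<open>c' powr s\<close>, so it has to be positive\<close>
  define c' where "c' = max c 1"
  define S where "S = interior K \<inter> N \<inter> U"
  have \<psi>: "continuous_on W \<psi>"
    using hom by (simp add: homeomorphism_def)
  have "open S"
    unfolding S_def using UW(1) N(1) by (intro open_Int open_interior)
  have T: "open (W \<inter> \<psi> -` S \<inter> V)"
    by (rule open_Int[OF continuous_open_preimage[OF \<psi> UW(2) \<open>open S\<close>] V(1)])
  have "0 \<in> W \<inter> \<psi> -` S \<inter> V"
  proof -
    have "\<psi> 0 = 0"
      using homeomorphism_apply1[OF hom UW(3)] unfolding UW(5) .
    then show ?thesis
      using UW(3,4) N(2) K(2) V(2) by (simp add: S_def)
  qed
  then obtain e where e: "0 < e" "cball 0 e \<subseteq> W \<inter> \<psi> -` S \<inter> V"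
    using T unfolding open_contains_cball by blast
  define B where "B = cball (0 :: 'a) e"
  have B: "compact B" "B \<subseteq> W" "\<psi> ` B \<subseteq> S" "B \<subseteq> V"
    using e by (auto simp: B_def)
  define H where "H x = neg_powr (u x) s * indicator K x" for x
  have H: "H \<in> borel_measurable borel"
    using K(3) by (simp add: H_def[abs_def])
  have pointwise: "neg_powr (v y) s \<le> ennreal (c' powr s) * H (\<psi> y)" if "y \<in> B" for y
  proof -
    have "\<psi> y \<in> S"
      using B(3) that by blast
    then have "\<psi> y \<in> N" "\<psi> y \<in> K"
      using interior_subset by (auto simp: S_def)
    moreover have "\<phi> (\<psi> y) = y"
      by (rule homeomorphism_apply2[OF hom subsetD[OF B(2) that]])
    ultimately have "u (\<psi> y) \<le> c * v y"
      using N(3)[of "\<psi> y"] by simp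
    also have "\<dots> \<le> c' * v y"
      using nonneg by (intro mult_right_mono) (auto simp: c'_def)
    finally have "neg_powr (v y) s \<le> ennreal (c' powr s) * neg_powr (u (\<psi> y)) s"
      by (intro neg_powr_antimono nonneg \<open>0 \<le> s\<close>) (auto simp: c'_def)
    then show ?thesis
      using \<open>\<psi> y \<in> K\<close> by (simp add: H_def)
  qed
  have \<psi>_B: "continuous_on B \<psi>"
    by (rule continuous_on_subset[OF \<psi> B(2)])
  have \<psi>_U: "\<psi> ` B \<subseteq> U"
    by (rule order_trans[OF B(3)]) (simp add: S_def)
  have \<psi>_inv: "\<phi> (\<psi> y) = y" if "y \<in> B" for y
    by (rule homeomorphism_apply2[OF hom subsetD[OF B(2) that]])
  have cH: "(\<lambda>x. ennreal (c' powr s) * H x) \<in> borel_measurable borel"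
    using H by simp
  have "(\<integral>\<^sup>+y\<in>B. neg_powr (v y) s \<partial>lborel) \<le> (\<integral>\<^sup>+y\<in>B. ennreal (c' powr s) * H (\<psi> y) \<partial>lborel)"
    by (rule nn_integral_mono) (simp add: pointwise split: split_indicator)
  also have "\<dots> \<le> ennreal ((5 * L) ^ DIM('a)) * (\<integral>\<^sup>+x. ennreal (c' powr s) * H x \<partial>lborel)"
    by (rule nn_integral_lipschitz_pullback_le[OF lip B(1) \<psi>_B \<psi>_U \<psi>_inv cH])
  also have "\<dots> < \<infinity>"
  proof -
    have "(\<integral>\<^sup>+x. H x \<partial>lborel) < \<infinity>"
      using K(4) by (simp add: H_def)
    then show ?thesis
      using H by (simp add: nn_integral_cmult ennreal_mult_less_top)
  qed
  finally have fin: "(\<integral>\<^sup>+y\<in>B. neg_powr (v y) s \<partial>lborel) < \<infinity>" .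
  have B_meas: "B \<in> sets borel"
    by (simp add: B_def)
  have "(\<lambda>y. indicator B y *\<^sub>R v y) \<in> borel_measurable borel"
    by (rule borel_measurable_continuous_on_indicator[OF B_meas continuous_on_subset[OF V(3) B(4)]])
  then have "(\<lambda>y. neg_powr (indicator B y *\<^sub>R v y) s) \<in> borel_measurable borel"
    by (rule measurable_compose[OF _ borel_measurable_neg_powr])
  then have "(\<lambda>y. neg_powr (indicator B y *\<^sub>R v y) s * indicator B y) \<in> borel_measurable borel"
    by (rule borel_measurable_times_ennreal[OF _ borel_measurable_indicator[OF B_meas]])
  moreover have "neg_powr (indicator B y *\<^sub>R v y) s * indicator B y = neg_powr (v y) s * indicator B y" for y
    by (simp split: split_indicator)
  ultimately have v_meas: "(\<lambda>y. neg_powr (v y) s * indicator B y) \<in> borel_measurable lborel"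
    by simp
  have "0 \<in> interior B"
    using e(1) by (simp add: B_def interior_cball)
  with B(1) v_meas fin show ?thesis
    unfolding integrable_near_origin_def by blast
qed

section \<open>Invariance of the log canonical threshold\<close>

lemma bilipschitz_homeo_germ_tendsto:
  assumes "bilipschitz_homeo_germ \<phi>"
  shows "(\<phi> \<longlongrightarrow> 0) (nhds 0)"
proof -
  obtain U V \<psi> C where U: "open U" "0 \<in> U" "\<phi> 0 = 0" "homeomorphism U V \<phi> \<psi>"
    using assms unfolding bilipschitz_homeo_germ_def bilipschitz_homeo_def by (elim exE conjE) (rule that)
  have "continuous_on U \<phi>"
    using U(4) by (simp add: homeomorphism_def)
  then have "(\<phi> \<longlongrightarrow> \<phi> 0) (at 0)"
    using U(1,2) continuous_on_eq_continuous_at[of U \<phi>] by (simp add: isCont_def)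
  then have "(\<phi> \<longlongrightarrow> \<phi> 0) (nhds 0)"
    by (simp only: tendsto_at_iff_tendsto_nhds)
  then show ?thesis
    unfolding U(3) .
qed

lemma bilipschitz_homeo_germ_inverse:
  assumes "bilipschitz_homeo_germ \<phi>"
  obtains \<psi> where "bilipschitz_homeo_germ \<psi>" "\<forall>\<^sub>F y in nhds 0. \<phi> (\<psi> y) = y"
proof -
  obtain U V \<psi> C where UV: "open U" "open V" "0 \<in> U" "0 \<in> V" "\<phi> 0 = 0"
      "homeomorphism U V \<phi> \<psi>" "C-lipschitz_on U \<phi>" "C-lipschitz_on V \<psi>"
    using assms unfolding bilipschitz_homeo_germ_def bilipschitz_homeo_def by (elim exE conjE) (rule that)
  have "\<psi> 0 = 0"
    using homeomorphism_apply1[OF UV(6,3)] unfolding UV(5) .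
  then have "bilipschitz_homeo V U \<psi>"
    unfolding bilipschitz_homeo_def
    by (intro conjI exI[of _ \<phi>] exI[of _ C] UV homeomorphism_symD[OF UV(6)])
  then have "bilipschitz_homeo_germ \<psi>"
    unfolding bilipschitz_homeo_germ_def by (intro exI)
  moreover have "\<forall>\<^sub>F y in nhds 0. \<phi> (\<psi> y) = y"
    using eventually_nhds_in_open[OF UV(2,4)]
    by eventually_elim (rule homeomorphism_apply2[OF UV(6)])
  ultimately show thesis
    by (rule that)
qed

lemma lct_function_mono:
  fixes f g :: "complex ^ 'n \<Rightarrow> complex"
  assumes g: "analytic_at_origin g" and \<phi>: "bilipschitz_homeo_germ \<phi>"
    and le: "\<forall>\<^sub>F x in nhds 0. cmod (f x) \<le> C * cmod (g (\<phi> x))"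
  shows "lct_function f \<le> lct_function g"
  unfolding lct_function_def
proof (rule Sup_subset_mono, rule image_mono, rule Collect_mono, rule impI, elim conjE, rule conjI)
  fix s :: real
  assume s: "0 \<le> s" and int: "integrable_near_origin (\<lambda>x. neg_powr (cmod (f x)) (2 * s))"
  obtain U where U: "open U" "0 \<in> U" "continuous_on U g"
    by (rule analytic_at_origin_continuous[OF g])
  show "integrable_near_origin (\<lambda>x. neg_powr (cmod (g x)) (2 * s))"
    by (rule integrable_near_origin_transfer[where u = "\<lambda>x. cmod (f x)" and v = "\<lambda>x. cmod (g x)",
          OF \<phi> _ U(1,2) continuous_on_norm[OF U(3)] _ _ le int]) (simp_all add: s)
qed assumption

text \<open>Since \<open>\<Phi>\<close> preserves the zero section, it maps \<open>(x, 0)\<close> to \<open>(\<phi> x, 0)\<close>, and it maps \<open>(x, f x)\<close> to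
\<open>(\<phi> x, g (\<phi> x))\<close>. The Lipschitz conditions for \<open>\<Phi>\<close> and its inverse at these two points are the two
inequalities. The hypothesis \<open>f 0 = 0\<close> keeps \<open>(x, f x)\<close> in the domain of \<open>\<Phi>\<close>.\<close>

lemma K_equivalent_comparable:
  fixes f g :: "complex ^ 'n \<Rightarrow> complex"
  assumes f: "analytic_at_origin f" "f 0 = 0" and "bilipschitz_K_equivalent f g"
  obtains \<phi> L where "bilipschitz_homeo_germ \<phi>"
    "\<forall>\<^sub>F x in nhds 0. cmod (g (\<phi> x)) \<le> L * cmod (f x)"
    "\<forall>\<^sub>F x in nhds 0. cmod (f x) \<le> L * cmod (g (\<phi> x))"
proof -
  obtain \<phi> \<theta> U V where \<phi>: "bilipschitz_homeo_germ \<phi>"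
    and hom: "bilipschitz_homeo U V (\<lambda>(x, y). (\<phi> x, \<theta> x y))"
    and zero: "(\<lambda>(x, y). (\<phi> x, \<theta> x y)) ` (U \<inter> UNIV \<times> {0}) = V \<inter> UNIV \<times> {0}"
    and fg: "\<forall>\<^sub>F x in nhds 0. \<theta> x (f x) = g (\<phi> x)"
    using assms(3) unfolding bilipschitz_K_equivalent_def by (elim exE conjE) (rule that)
  define \<Phi> where "\<Phi> = (\<lambda>(x, y). (\<phi> x, \<theta> x y))"
  obtain \<Psi> L where U: "open U" "0 \<in> U" and homeo: "homeomorphism U V \<Phi> \<Psi>"
    and lip: "L-lipschitz_on U \<Phi>" "L-lipschitz_on V \<Psi>"
    using hom unfolding bilipschitz_homeo_def \<Phi>_def[symmetric] by (elim exE conjE) (rule that)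
  have "((\<lambda>x. (x, f x)) \<longlongrightarrow> (0, f 0)) (nhds 0)"
    by (intro tendsto_Pair analytic_at_origin_tendsto[OF f(1)] filterlim_ident)
  then have "\<forall>\<^sub>F x in nhds 0. (x, f x) \<in> U"
    by (rule topological_tendstoD[OF _ U(1)]) (use U(2) f(2) in \<open>simp add: zero_prod_def\<close>)
  moreover have "((\<lambda>x :: complex ^ 'n. (x, 0 :: complex)) \<longlongrightarrow> (0, 0)) (nhds 0)"
    by (intro tendsto_Pair tendsto_const filterlim_ident)
  then have "\<forall>\<^sub>F x in nhds 0. (x, 0) \<in> U"
    by (rule topological_tendstoD[OF _ U(1)]) (use U(2) in \<open>simp add: zero_prod_def\<close>)
  ultimately have both: "\<forall>\<^sub>F x in nhds 0. cmod (g (\<phi> x)) \<le> L * cmod (f x) \<and> cmod (f x) \<le> L * cmod (g (\<phi> x))"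
    using fg
  proof eventually_elim
    case (elim x)
    have "\<Phi> (x, 0) \<in> V \<inter> UNIV \<times> {0}"
      unfolding zero[symmetric] \<Phi>_def using elim(2) by (intro imageI) simp
    then have \<Phi>0: "\<Phi> (x, 0) = (\<phi> x, 0)"
      by (auto simp: \<Phi>_def)
    have \<Phi>f: "\<Phi> (x, f x) = (\<phi> x, g (\<phi> x))"
      using elim(3) by (simp add: \<Phi>_def)
    have d: "dist (\<Phi> (x, f x)) (\<Phi> (x, 0)) = cmod (g (\<phi> x))" "dist (x, f x) (x, 0) = cmod (f x)"
      unfolding \<Phi>0 \<Phi>f by (simp_all add: dist_Pair_Pair)
    have V: "\<Phi> (x, f x) \<in> V" "\<Phi> (x, 0) \<in> V"
      using homeomorphism_image1[OF homeo] elim(1,2) by blast+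
    have inv: "\<Psi> (\<Phi> (x, f x)) = (x, f x)" "\<Psi> (\<Phi> (x, 0)) = (x, 0)"
      using homeomorphism_apply1[OF homeo] elim(1,2) by blast+
    have "cmod (g (\<phi> x)) \<le> L * cmod (f x)"
      using lipschitz_onD[OF lip(1) elim(1,2)] unfolding d .
    moreover have "cmod (f x) \<le> L * cmod (g (\<phi> x))"
      using lipschitz_onD[OF lip(2) V] unfolding inv d .
    ultimately show ?case ..
  qed
  have "\<forall>\<^sub>F x in nhds 0. cmod (g (\<phi> x)) \<le> L * cmod (f x)"
    "\<forall>\<^sub>F x in nhds 0. cmod (f x) \<le> L * cmod (g (\<phi> x))"
    using both by (auto elim: eventually_mono)
  with \<phi> show thesis
    by (rule that)
qed

lemma lct_function_K_equivalent:
  fixes f g :: "complex ^ 'n \<Rightarrow> complex"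
  assumes f: "analytic_at_origin f" "f 0 = 0" and g: "analytic_at_origin g"
    and "bilipschitz_K_equivalent f g"
  shows "lct_function f = lct_function g"
proof (rule antisym)
  obtain \<phi> L where \<phi>: "bilipschitz_homeo_germ \<phi>"
    and le: "\<forall>\<^sub>F x in nhds 0. cmod (g (\<phi> x)) \<le> L * cmod (f x)"
      "\<forall>\<^sub>F x in nhds 0. cmod (f x) \<le> L * cmod (g (\<phi> x))"
    by (rule K_equivalent_comparable[OF f assms(4)])
  show "lct_function f \<le> lct_function g"
    by (rule lct_function_mono[OF g \<phi> le(2)])
  obtain \<psi> where \<psi>: "bilipschitz_homeo_germ \<psi>" "\<forall>\<^sub>F y in nhds 0. \<phi> (\<psi> y) = y"
    by (rule bilipschitz_homeo_germ_inverse[OF \<phi>])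
  have "\<forall>\<^sub>F y in nhds 0. cmod (g y) \<le> L * cmod (f (\<psi> y))"
    using eventually_compose_filterlim[OF le(1) bilipschitz_homeo_germ_tendsto[OF \<psi>(1)]] \<psi>(2)
    by eventually_elim simp
  then show "lct_function g \<le> lct_function f"
    by (rule lct_function_mono[OF f(1) \<psi>(1)])
qed

lemma tuple_norm_continuous:
  fixes hs :: "(complex ^ 'n \<Rightarrow> complex) list"
  assumes "\<forall>h\<in>set hs. analytic_at_origin h"
  obtains U where "open U" "0 \<in> U" "continuous_on U (tuple_norm hs)"
proof -
  have "\<exists>U. open U \<and> 0 \<in> U \<and> (\<forall>h\<in>set hs. continuous_on U h)"
    using assms
  proof (induction hs)
    case Nil
    show ?case
      by (rule exI[of _ UNIV]) simp
  next
    case (Cons h hs)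
    then obtain U where U: "open U" "0 \<in> U" "\<forall>h\<in>set hs. continuous_on U h"
      by auto
    have "analytic_at_origin h"
      using Cons.prems by simp
    then obtain U' where U': "open U'" "0 \<in> U'" "continuous_on U' h"
      by (rule analytic_at_origin_continuous)
    have "continuous_on (U \<inter> U') h'" if "h' \<in> set (h # hs)" for h'
      using U(3) U'(3) that by (auto intro: continuous_on_subset)
    with U(1,2) U'(1,2) show ?case
      by (intro exI[of _ "U \<inter> U'"]) auto
  qed
  then obtain U where U: "open U" "0 \<in> U" "\<forall>h\<in>set hs. continuous_on U h"
    by blast
  have "continuous_on U (\<lambda>x. \<Sum>h\<leftarrow>hs. (cmod (h x))\<^sup>2)"
    using U(3) by (induction hs) (auto intro!: continuous_intros)
  then have "continuous_on U (tuple_norm hs)"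
    unfolding tuple_norm_def by (rule continuous_on_real_sqrt)
  with U(1,2) show thesis
    by (rule that)
qed

lemma eventually_le_mult_trans:
  fixes u v w :: "'a \<Rightarrow> real"
  assumes "\<forall>\<^sub>F x in F. u x \<le> C * v x" "\<forall>\<^sub>F x in F. v x \<le> D * w x" "\<And>x. 0 \<le> v x"
  shows "\<forall>\<^sub>F x in F. u x \<le> \<bar>C\<bar> * D * w x"
  using assms(1,2)
proof eventually_elim
  case (elim x)
  have "u x \<le> \<bar>C\<bar> * v x"
    using elim(1) mult_right_mono[OF abs_ge_self[of C] assms(3)[of x]] by linarith
  also have "\<dots> \<le> \<bar>C\<bar> * (D * w x)"
    using elim(2) by (intro mult_left_mono) auto
  finally show ?case
    by (simp add: mult.assoc)
qed

text \<open>Given generators \<open>ks\<close> of \<open>I\<close> with integrable power and any generators \<open>js\<close> of \<open>J\<close>, the norm of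
\<open>ks\<close> is bounded by that of \<open>fs\<close>, then of \<open>gs \<circ> \<phi>\<close>, then of \<open>js \<circ> \<phi>\<close>.\<close>

lemma lct_ideal_mono:
  fixes I J :: "(complex ^ 'n \<Rightarrow> complex) set set"
  assumes I: "ideal I \<O>" and J: "ideal J \<O>"
    and fs: "\<forall>f\<in>set fs. analytic_at_origin f" "ideal_generated_by fs \<subseteq> I"
      "integral_closure \<O> (ideal_generated_by fs) = integral_closure \<O> I"
    and gs: "\<forall>g\<in>set gs. analytic_at_origin g" "ideal_generated_by gs \<subseteq> J"
      "integral_closure \<O> (ideal_generated_by gs) = integral_closure \<O> J"
    and \<phi>: "bilipschitz_homeo_germ \<phi>"
    and le: "\<forall>\<^sub>F x in nhds 0. tuple_norm fs x \<le> C * tuple_norm gs (\<phi> x)"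
  shows "lct_ideal I \<le> lct_ideal J"
  unfolding lct_ideal_def
proof (rule Sup_subset_mono, rule image_mono, rule Collect_mono, rule impI, elim conjE exE, intro conjI)
  fix s :: real and ks
  assume s: "0 \<le> s" and ks: "\<forall>g\<in>set ks. analytic_at_origin g" "I = ideal_generated_by ks"
    and int: "integrable_near_origin (\<lambda>x. neg_powr (\<Sum>g\<leftarrow>ks. (cmod (g x))\<^sup>2) s)"
  obtain js where js: "\<forall>g\<in>set js. analytic_at_origin g" "J = ideal_generated_by js"
    by (rule germ_ring_noetherian[OF J])
  obtain D where D: "\<forall>\<^sub>F x in nhds 0. tuple_norm ks x \<le> D * tuple_norm fs x"
    by (rule generators_equivalent[OF I ks fs])
  obtain D' where "\<forall>\<^sub>F y in nhds 0. tuple_norm gs y \<le> D' * tuple_norm js y"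
    by (rule generators_equivalent[OF J js gs])
  then have D': "\<forall>\<^sub>F x in nhds 0. tuple_norm gs (\<phi> x) \<le> D' * tuple_norm js (\<phi> x)"
    by (rule eventually_compose_filterlim[OF _ bilipschitz_homeo_germ_tendsto[OF \<phi>]])
  obtain K where K: "\<forall>\<^sub>F x in nhds 0. tuple_norm ks x \<le> K * tuple_norm js (\<phi> x)"
    by (rule that[OF eventually_le_mult_trans
          [OF eventually_le_mult_trans[OF D le tuple_norm_simps(3)] D' tuple_norm_simps(3)]])
  have le2: "\<forall>\<^sub>F x in nhds 0. (tuple_norm ks x)\<^sup>2 \<le> K\<^sup>2 * (tuple_norm js (\<phi> x))\<^sup>2"
    using K by eventually_elim (simp add: power_mono tuple_norm_simps(3) flip: power_mult_distrib)
  obtain U where U: "open U" "0 \<in> U" "continuous_on U (tuple_norm js)"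
    by (rule tuple_norm_continuous[OF js(1)])
  have int': "integrable_near_origin (\<lambda>x. neg_powr ((tuple_norm ks x)\<^sup>2) s)"
    using int unfolding tuple_norm_simps(4) .
  have "integrable_near_origin (\<lambda>x. neg_powr ((tuple_norm js x)\<^sup>2) s)"
    by (rule integrable_near_origin_transfer[where u = "\<lambda>x. (tuple_norm ks x)\<^sup>2"
          and v = "\<lambda>x. (tuple_norm js x)\<^sup>2",
          OF \<phi> s U(1,2) continuous_on_power[OF U(3)] zero_le_power2 zero_le_power2 le2 int'])
  then show "\<exists>gs. (\<forall>g\<in>set gs. analytic_at_origin g) \<and> J = ideal_generated_by gs \<and>
      integrable_near_origin (\<lambda>x. neg_powr (\<Sum>g\<leftarrow>gs. (cmod (g x))\<^sup>2) s)"
    unfolding tuple_norm_simps(4) by (intro exI[of _ js] conjI js)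
qed assumption

lemma lct_ideal_bilipschitz_equivalent:
  fixes I J :: "(complex ^ 'n \<Rightarrow> complex) set set"
  assumes I: "ideal I \<O>" and J: "ideal J \<O>" and "bilipschitz_equivalent_ideals I J"
  shows "lct_ideal I = lct_ideal J"
proof (rule antisym)
  obtain fs gs \<phi> where
    fs: "\<forall>f\<in>set fs. analytic_at_origin f" "ideal_generated_by fs \<subseteq> I"
      "integral_closure \<O> (ideal_generated_by fs) = integral_closure \<O> I"
    and gs: "\<forall>g\<in>set gs. analytic_at_origin g" "ideal_generated_by gs \<subseteq> J"
      "integral_closure \<O> (ideal_generated_by gs) = integral_closure \<O> J"
    and \<phi>: "bilipschitz_homeo_germ \<phi>"
    and \<Theta>: "tuple_norm fs \<in> \<Theta>[nhds 0](\<lambda>x. tuple_norm gs (\<phi> x))"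
    using assms(3) unfolding bilipschitz_equivalent_ideals_def by (elim exE conjE) (rule that)
  obtain C where "\<forall>\<^sub>F x in nhds 0. norm (tuple_norm fs x) \<le> C * norm (tuple_norm gs (\<phi> x))"
    using bigthetaD1[OF \<Theta>] by (rule landau_o.bigE)
  then have C: "\<forall>\<^sub>F x in nhds 0. tuple_norm fs x \<le> C * tuple_norm gs (\<phi> x)"
    by (simp add: tuple_norm_simps(3))
  show "lct_ideal I \<le> lct_ideal J"
    by (rule lct_ideal_mono[OF I J fs gs \<phi> C])
  have "(\<lambda>x. tuple_norm gs (\<phi> x)) \<in> O[nhds 0](tuple_norm fs)"
    using \<Theta> by (subst (asm) bigtheta_sym) (rule bigthetaD1)
  then obtain D where "\<forall>\<^sub>F x in nhds 0. norm (tuple_norm gs (\<phi> x)) \<le> D * norm (tuple_norm fs x)"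
    by (rule landau_o.bigE)
  then have D: "\<forall>\<^sub>F x in nhds 0. tuple_norm gs (\<phi> x) \<le> D * tuple_norm fs x"
    by (simp add: tuple_norm_simps(3))
  obtain \<psi> where \<psi>: "bilipschitz_homeo_germ \<psi>" "\<forall>\<^sub>F y in nhds 0. \<phi> (\<psi> y) = y"
    by (rule bilipschitz_homeo_germ_inverse[OF \<phi>])
  have "\<forall>\<^sub>F y in nhds 0. tuple_norm gs y \<le> D * tuple_norm fs (\<psi> y)"
    using eventually_compose_filterlim[OF D bilipschitz_homeo_germ_tendsto[OF \<psi>(1)]] \<psi>(2)
    by eventually_elim simp
  then show "lct_ideal J \<le> lct_ideal I"
    by (rule lct_ideal_mono[OF J I gs fs \<psi>(1)])
qed

theorem theorem7p3:
  shows "(\<forall>f g :: complex ^ 'n \<Rightarrow> complex.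
            analytic_at_origin f \<and> f 0 = 0 \<and> analytic_at_origin g \<and> g 0 = 0 \<and>
            bilipschitz_K_equivalent f g \<longrightarrow> lct_function f = lct_function g) \<and>
         (\<forall>I J :: (complex ^ 'n \<Rightarrow> complex) set set.
            ideal I \<O> \<and> ideal J \<O> \<and>
            bilipschitz_equivalent_ideals I J \<longrightarrow> lct_ideal I = lct_ideal J)"
  using lct_function_K_equivalent lct_ideal_bilipschitz_equivalent by blast

end
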